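(* (Second interlacing property.) Let $n$ be a positive integer and let $j$ be an integer with $1\le j\le n-5$. Let $Q_j$ and $Q_{j+2}$ be the polynomials (depending on $n$) defined in the context. Let $0<x_1<\cdots<x_j$ be the roots of $Q_j$ and $0<z_1<\cdots<z_{j+2}$ the roots of $Q_{j+2}$. Then for $i=1,\dots,\lfloor j/2\rfloor$ one has $x_i\in(z_i,z_{i+1})$ and $x_{j+1-i}\in(z_{j+2-i},z_{j+3-i})$. If $j$ is odd, then $x_{(j+1)/2}=z_{(j+3)/2}=1$.
   Context: Fix $n$. For polynomials $P=\sum_{j=0}^n p_jx^j$ and $Q=\sum_{j=0}^n q_jx^j$, the Schur-Szegő composition (with respect to degree $n$) is $P\ast Q:=\sum_{j=0}^n p_jq_jx^j/\binom{n}{j}$; it is associative and commutative, and for several polynomials it is defined by iteration. For $a\in\mathbb{C}$ put $K_a:=(x+1)^{n-1}(x+a)$. It is known that every monic complex polynomial $P$ of degree $n$ with $P(-1)=0$ can be written as $P=K_{a_1}\ast\cdots\ast K_{a_{n-1}}$ with $a_1,\dots,a_{n-1}\in\mathbb{C}$ unique up to permutation. Write $P=(x+1)(x^{n-1}+c_1x^{n-2}+\cdots+c_{n-1})$ and let $\sigma_j$ be the $j$th elementary symmetric polynomial of $a_1,\dots,a_{n-1}$. It is known that $(c_1,\dots,c_{n-1})\mapsto(\sigma_1,\dots,\sigma_{n-1})$ is an affine map; it extends to a linear map $(c_0,c_1,\dots,c_{n-1})\mapsto(\sigma_0,\sigma_1,\dots,\sigma_{n-1})$ with $\sigma_0=c_0$.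 We regard it as a linear map $\Phi$ on the space of polynomials of degree $\le n$ vanishing at $-1$: $\Phi\big((x+1)\sum_{i=0}^{n-1}c_ix^{n-1-i}\big)=(x+1)\sum_{i=0}^{n-1}\sigma_ix^{n-1-i}$. Thus $\Phi$ is the unique linear map of this space with $\Phi(K_{a_1}\ast\cdots\ast K_{a_{n-1}})=(x+1)\prod_{i=1}^{n-1}(x+a_i)$ for all $a_1,\dots,a_{n-1}$. It is known that for $1\le j\le n-3$ the number $\frac{n^{j+1}}{(n-1)(n-2)\cdots(n-j-1)}$ is an eigenvalue of $\Phi$ whose eigenspace is one-dimensional and spanned by a polynomial of the form $x(x+1)^{n-2-j}Q_j(x)$ with $Q_j$ real, monic of degree $j$; this defines $Q_j$. It is known that all roots of $Q_j$ are real, positive and distinct and that $x^jQ_j(1/x)=\pm Q_j(x)$. *)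

theory Defs
  imports Complex_Main "HOL-Computational_Algebra.Polynomial"
begin

definition schur_szego :: "nat \<Rightarrow> complex poly \<Rightarrow> complex poly \<Rightarrow> complex poly" where
  "schur_szego n P Q =
     (\<Sum>j\<le>n. monom (coeff P j * coeff Q j / of_nat (n choose j)) j)"

definition K :: "nat \<Rightarrow> complex \<Rightarrow> complex poly" where
  "K n a = [:1, 1:] ^ (n - 1) * [:a, 1:]"

text \<open>The iterated composition starts from \<open>(x + 1)^n\<close>, which is neutral for the composition of
  polynomials of degree at most \<open>n\<close> (lemma \<open>schur_szego_neutral\<close>).\<close>

definition schur_szego_list :: "nat \<Rightarrow> complex poly list \<Rightarrow> complex poly" where
  "schur_szego_list n Ps = foldr (schur_szego n) Ps ([:1, 1:] ^ n)"

lemma schur_szego_neutral: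
  assumes "degree P \<le> n"
  shows "schur_szego n P ([:1, 1:] ^ n) = P"
proof -
  have "schur_szego n P ([:1, 1:] ^ n) = (\<Sum>j\<le>n. monom (coeff P j) j)"
    unfolding schur_szego_def by (intro sum.cong) (auto simp: coeff_linear_poly_power)
  also have "\<dots> = P"
    using assms by (rule poly_as_sum_of_monoms')
  finally show ?thesis .
qed

definition polys_vanishing :: "nat \<Rightarrow> complex poly set" where
  "polys_vanishing n = {P. degree P \<le> n \<and> poly P (-1) = 0}"

text \<open>The predicate determines \<open>\<Phi>\<close> on \<open>polys_vanishing n\<close> only; its values
  elsewhere are arbitrary and never used.\<close>

definition is_Phi :: "nat \<Rightarrow> (complex poly \<Rightarrow> complex poly) \<Rightarrow> bool" where
  "is_Phi n \<Phi> \<longleftrightarrow>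
     (\<forall>P\<in>polys_vanishing n. \<Phi> P \<in> polys_vanishing n) \<and>
     (\<forall>P\<in>polys_vanishing n. \<forall>R\<in>polys_vanishing n. \<Phi> (P + R) = \<Phi> P + \<Phi> R) \<and>
     (\<forall>c. \<forall>P\<in>polys_vanishing n. \<Phi> (smult c P) = smult c (\<Phi> P)) \<and>
     (\<forall>as. length as = n - 1 \<longrightarrow>
        \<Phi> (schur_szego_list n (map (K n) as)) = [:1, 1:] * (\<Prod>a\<leftarrow>as. [:a, 1:]))"

definition eigenspace :: "nat \<Rightarrow> (complex poly \<Rightarrow> complex poly) \<Rightarrow> complex \<Rightarrow> complex poly set" where
  "eigenspace n \<Phi> \<mu> = {P \<in> polys_vanishing n. \<Phi> P = smult \<mu> P}"

definition eigenval :: "nat \<Rightarrow> nat \<Rightarrow> complex" where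
  "eigenval n j = of_nat n ^ (j + 1) / (\<Prod>i=1..j+1. of_nat n - of_nat i)"

definition is_Q :: "nat \<Rightarrow> (complex poly \<Rightarrow> complex poly) \<Rightarrow> nat \<Rightarrow> real poly \<Rightarrow> bool" where
  "is_Q n \<Phi> j Q \<longleftrightarrow> degree Q = j \<and> lead_coeff Q = 1 \<and>
     eigenspace n \<Phi> (eigenval n j) =
       range (\<lambda>c. smult c ([:0, 1:] * [:1, 1:] ^ (n - 2 - j) * map_poly of_real Q))"

text \<open>\<open>x 1, \<dots>, x m\<close> are the roots of \<open>Q\<close>, all positive, in increasing order; for \<open>Q\<close> of
  degree \<open>m\<close> these are all complex roots.\<close>

definition positive_roots_enum :: "real poly \<Rightarrow> nat \<Rightarrow> (nat \<Rightarrow> real) \<Rightarrow> bool" where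
  "positive_roots_enum Q m x \<longleftrightarrow>
     strict_mono_on {1..m} x \<and> (\<forall>i\<in>{1..m}. 0 < x i) \<and> x ` {1..m} = {t. poly Q t = 0}"

end

theory Submission
  imports Defs "HOL-Computational_Algebra.Fundamental_Theorem_Algebra"
begin

text \<open>Comparing coefficients, the inverse \<open>\<Psi>\<close> of \<open>\<Phi>\<close> sends \<open>(x + 1) S\<close> to
  \<open>\<Sum>\<^sub>k (n choose k) S\<^sup>h(k, n - k) x\<^sup>k / n\<^sup>n\<^sup>-\<^sup>1\<close>, where \<open>S\<^sup>h\<close> is the homogenization of \<open>S\<close> in
  degree \<open>n - 1\<close>. By Descartes' rule of signs \<open>\<Psi>\<close> does not increase the number of sign changes
  on \<open>(0, \<infinity>)\<close>. Put \<open>A = (1 + x)\<^sup>2 Q\<^sub>j\<close> and \<open>B = Q\<^sub>j\<^sub>+\<^sub>2\<close>. Iterating \<open>\<Psi>\<close> on \<open>A + \<delta> B\<close> suppresses the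
  \<open>B\<close>-component, so every \<open>A + \<delta> B\<close> changes sign at least as often as \<open>Q\<^sub>j\<close>, that is \<open>j\<close> times.
  A zero \<open>t \<noteq> 1\<close> of the Wronskian of \<open>A\<close> and \<open>B\<close> would make some \<open>A + \<delta> B\<close> divisible by
  \<open>(x - t)\<^sup>2 (x - 1/t)\<^sup>2\<close>, using the symmetry under \<open>x \<mapsto> 1/x\<close>, leaving a cofactor of degree at most
  \<open>j - 2\<close> with \<open>j\<close> sign changes. So the Wronskian has no zero in \<open>(0, 1)\<close>, which by Rolle's theorem
  for \<open>B / A\<close> puts a root of \<open>Q\<^sub>j\<close> between any two consecutive roots of \<open>Q\<^sub>j\<^sub>+\<^sub>2\<close> below \<open>1\<close>; the rest
  follows by counting and symmetry.\<close>

subsection \<open>Descartes' rule of signs\<close>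

text \<open>The sign of \<open>s\<close> fixes the sign at the first point, so both sign patterns
  are covered. The general linear order lets one notion serve for values on the positive axis and
  for coefficient sequences indexed by naturals.\<close>

definition alternates :: "'a::linorder set \<Rightarrow> ('a \<Rightarrow> real) \<Rightarrow> nat \<Rightarrow> bool" where
  "alternates X f k \<longleftrightarrow>
     (\<exists>t s. strict_mono_on {..k} t \<and> t ` {..k} \<subseteq> X \<and> (\<forall>i\<le>k. 0 < s * (-1) ^ i * f (t i)))"

lemma alternatesE:
  assumes "alternates X f k"
  obtains t s where "\<And>i j. i < j \<Longrightarrow> j \<le> k \<Longrightarrow> t i < t j" "\<And>i. i \<le> k \<Longrightarrow> t i \<in> X"
    "\<And>i. i \<le> k \<Longrightarrow> 0 < s * (-1) ^ i * f (t i)"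
proof -
  from assms obtain t s where 1: "strict_mono_on {..k} t" "t ` {..k} \<subseteq> X"
    "\<forall>i\<le>k. 0 < s * (-1) ^ i * f (t i)"
    unfolding alternates_def by blast
  show thesis
  proof (rule that)
    show "t i < t j" if "i < j" "j \<le> k" for i j
      using 1(1) that by (auto simp: strict_mono_on_def)
    show "t i \<in> X" if "i \<le> k" for i
      using 1(2) that by blast
    show "0 < s * (-1) ^ i * f (t i)" if "i \<le> k" for i
      using 1(3) that by blast
  qed
qed

lemma alternatesI:
  assumes "\<And>i. i < k \<Longrightarrow> t i < t (Suc i)" "\<And>i. i \<le> k \<Longrightarrow> t i \<in> X"
    "\<And>i. i \<le> k \<Longrightarrow> 0 < s * (-1) ^ i * f (t i)"
  shows "alternates X f k"
proof -
  have "t i < t j" if "i < j" "j \<le> k" for i j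
    using that
  proof (induction j)
    case (Suc j)
    then have "t i \<le> t j" by (cases "i = j") auto
    also have "t j < t (Suc j)" using Suc.prems assms(1) by simp
    finally show ?case .
  qed simp
  then have "strict_mono_on {..k} t"
    by (auto simp: strict_mono_on_def)
  with assms(2,3) show ?thesis
    unfolding alternates_def by blast
qed

lemma alternates_appendI:
  fixes t :: "nat \<Rightarrow> 'a::linorder"
  assumes "\<And>i j. i < j \<Longrightarrow> j \<le> k \<Longrightarrow> t i < t j" "\<And>i. i \<le> k \<Longrightarrow> t i \<in> X"
    "\<And>i. i \<le> k \<Longrightarrow> 0 < s * (-1) ^ i * f (t i)"
    and "t k < d" "d \<in> X" "0 < s * (-1) ^ Suc k * f d"
  shows "alternates X f (Suc k)"
proof (rule alternatesI)
  let ?t = "t(Suc k := d)"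
  show "?t i < ?t (Suc i)" if "i < Suc k" for i
    using that assms(1)[of i "Suc i"] assms(4) by (cases "i = k") auto
  show "?t i \<in> X" if "i \<le> Suc k" for i
    using that assms(2,5) by auto
  show "0 < s * (-1) ^ i * f (?t i)" if "i \<le> Suc k" for i
    using that assms(3)[of i] assms(6) by (cases "i = Suc k") auto
qed

text \<open>Rolle's theorem for the function \<open>x\<^sup>-\<^sup>c p(x)\<close>.\<close>

lemma alternates_euler_derivative:
  fixes p :: "real poly"
  assumes "alternates {0<..} (poly p) (Suc k)"
  shows "alternates {0<..} (poly (pCons 0 (pderiv p) - smult c p)) k"
proof -
  define h where "h x = x powr (-c) * poly p x" for x
  define q where "q = pCons 0 (pderiv p) - smult c p"
  obtain t s where t: "\<And>i j. i < j \<Longrightarrow> j \<le> Suc k \<Longrightarrow> t i < t j"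
    and pos: "\<And>i. i \<le> Suc k \<Longrightarrow> t i \<in> {0<..}"
    and alt: "\<And>i. i \<le> Suc k \<Longrightarrow> 0 < s * (-1) ^ i * poly p (t i)"
    using assms by (rule alternatesE) blast
  \<comment> \<open>The power of \<open>x\<close> is positive, so the slope of \<open>h\<close> has
    the sign of \<open>q\<close>.\<close>
  have h': "(h has_real_derivative x powr (-c-1) * poly q x) (at x)" if "x > 0" for x
  proof -
    have "x powr (-c) = x powr (-c-1) * x"
      using that by (simp add: powr_diff)
    then show ?thesis
      unfolding h_def using that
      by (auto intro!: derivative_eq_intros simp: q_def algebra_simps)
  qed
  have "\<exists>u. t i < u \<and> u < t (Suc i) \<and>
          h (t (Suc i)) - h (t i) = (t (Suc i) - t i) * (u powr (-c-1) * poly q u)"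
    if "i \<le> k" for i
  proof (rule MVT2)
    show "t i < t (Suc i)" using t that by simp
    show "(h has_real_derivative x powr (-c-1) * poly q x) (at x)"
      if "t i \<le> x" "x \<le> t (Suc i)" for x
      using pos[of i] that \<open>i \<le> k\<close> by (intro h') auto
  qed
  then obtain u where u: "\<And>i. i \<le> k \<Longrightarrow> t i < u i" "\<And>i. i \<le> k \<Longrightarrow> u i < t (Suc i)"
    "\<And>i. i \<le> k \<Longrightarrow> h (t (Suc i)) - h (t i) = (t (Suc i) - t i) * (u i powr (-c-1) * poly q (u i))"
    by metis
  have "alternates {0<..} (poly q) k"
  proof (rule alternatesI)
    show "u i < u (Suc i)" if "i < k" for i
      using u(2)[of i] u(1)[of "Suc i"] that by simp
    show upos: "u i \<in> {0<..}" if "i \<le> k" for i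
      using u(1)[of i] pos[of i] that by simp
    \<comment> \<open>Between \<open>t i\<close> and \<open>t (Suc i)\<close> the function
      \<open>h\<close> passes to the opposite sign, so its slope there has the sign opposite to
      \<open>h (t i)\<close>; hence \<open>- s\<close>.\<close>
    show "0 < - s * (-1) ^ i * poly q (u i)" if "i \<le> k" for i
    proof -
      have hsgn: "0 < s * (-1) ^ l * h (t l)" if "l \<le> Suc k" for l
      proof -
        have "0 < t l powr (-c) * (s * (-1) ^ l * poly p (t l))"
          using alt[OF that] pos[OF that] by simp
        then show ?thesis by (simp add: h_def mult_ac)
      qed
      have "0 < - s * (-1) ^ i * (h (t (Suc i)) - h (t i))"
        using hsgn[of i] hsgn[of "Suc i"] that by (simp add: algebra_simps)
      also have "\<dots> = ((t (Suc i) - t i) * u i powr (-c-1)) * (- s * (-1) ^ i * poly q (u i))"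
        using u(3)[OF that] by simp
      finally have "0 < ((t (Suc i) - t i) * u i powr (-c-1)) * (- s * (-1) ^ i * poly q (u i))" .
      moreover have "0 < (t (Suc i) - t i) * u i powr (-c-1)"
        using t[of i "Suc i"] upos[OF that] that by simp
      ultimately show ?thesis by (rule zero_less_mult_pos)
    qed
  qed
  then show ?thesis by (simp only: q_def)
qed

lemma poly_nonneg_if_coeffs_nonneg:
  fixes p :: "real poly"
  assumes "\<And>i. coeff p i \<ge> 0" "x \<ge> 0"
  shows "poly p x \<ge> 0"
  using assms by (auto simp: poly_altdef intro!: sum_nonneg)

text \<open>Induction on \<open>k\<close>. By Rolle, passing from \<open>p\<close> to
  \<open>x p' - c p\<close> loses at most one sign change on the positive axis. On coefficients it
  multiplies the \<open>l\<close>-th one by \<open>l - c\<close>, which removes one sign change if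
  \<open>c\<close> sits at a change. So the alternation found for the new polynomial extends by one
  index for \<open>p\<close>.\<close>

lemma descartes_rule_alternates:
  fixes p :: "real poly"
  assumes "alternates {0<..} (poly p) k"
  shows "alternates UNIV (coeff p) k"
  using assms
proof (induction k arbitrary: p)
  case 0
  then obtain t s where "0 < s * (-1) ^ 0 * poly p (t (0::nat))"
    by (elim alternatesE) blast
  then have "p \<noteq> 0" by auto
  then show ?case
    by (intro alternatesI[where t = "\<lambda>_. degree p" and s = "lead_coeff p"])
       (auto simp flip: power2_eq_square)
next
  case (Suc k)
  define e where "e = lead_coeff p"
  obtain t s where "\<And>i j. i < j \<Longrightarrow> j \<le> Suc k \<Longrightarrow> t i < t j"
    and pos: "\<And>i. i \<le> Suc k \<Longrightarrow> t i \<in> {0<..}"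
    and alt: "\<And>i. i \<le> Suc k \<Longrightarrow> 0 < s * (-1) ^ i * poly p (t i)"
    using Suc.prems by (rule alternatesE) blast
  have "p \<noteq> 0" using alt[of 0] by auto
  then have e0: "e \<noteq> 0" by (simp add: e_def)
  \<comment> \<open>If no coefficient had the sign opposite to \<open>e\<close>, then
    \<open>e p\<close> would be nonnegative on the positive axis, against the opposite signs of
    \<open>p\<close> at \<open>t 0\<close> and \<open>t 1\<close>.\<close>
  have "\<exists>l. coeff p l * e < 0"
  proof (rule ccontr)
    assume "\<not> ?thesis"
    then have "poly (smult e p) (t i) \<ge> 0" if "i \<le> 1" for i
      using pos[of i] that
      by (intro poly_nonneg_if_coeffs_nonneg) (auto simp: not_less mult.commute)
    from this[of 0] this[of 1] alt[of 0] alt[of 1] e0 show False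
      by (auto simp: zero_le_mult_iff zero_less_mult_iff mult_less_0_iff)
  qed
  moreover have fin: "finite {l. coeff p l * e < 0}"
    by (rule finite_subset[of _ "{..degree p}"]) (auto intro!: le_degree)
  define r where "r = Max {l. coeff p l * e < 0}"
  ultimately have r: "coeff p r * e < 0"
    using Max_in[OF fin] by auto
  have r_max: "coeff p l * e \<ge> 0" if "l > r" for l
    using Max_ge[OF fin, of l] that by (force simp: r_def)
  have "r \<noteq> degree p"
    using r by (auto simp: e_def mult_less_0_iff)
  moreover have "r \<le> degree p"
    using r by (intro le_degree) auto
  ultimately have rd: "r < degree p" by simp
  \<comment> \<open>\<open>c\<close> lies just above the last sign change \<open>r\<close>: passing from \<open>coeff p l\<close> to
    \<open>(l - c) * coeff p l\<close> removes exactly this sign change.\<close>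
  define c where "c = real r + 1 / 2"
  define q where "q = pCons 0 (pderiv p) - smult c p"
  have coeff_q: "coeff q l = (real l - c) * coeff p l" for l
    by (cases l) (auto simp: q_def coeff_pderiv algebra_simps)
  have q_above: "coeff q l * e \<ge> 0" if "l > r" for l
  proof -
    have "0 \<le> (real l - c) * (coeff p l * e)"
      by (rule mult_nonneg_nonneg[OF _ r_max[OF that]]) (use that in \<open>simp add: c_def\<close>)
    then show ?thesis by (simp add: coeff_q mult_ac)
  qed
  have q_r: "coeff q r * e > 0"
    using r by (simp add: coeff_q c_def)
  have "alternates UNIV (coeff q) k"
    unfolding q_def by (intro Suc.IH alternates_euler_derivative Suc.prems)
  then obtain l0 \<sigma> where l0: "\<And>i j. i < j \<Longrightarrow> j \<le> k \<Longrightarrow> l0 i < l0 j"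
    and "\<And>i. i \<le> k \<Longrightarrow> l0 i \<in> UNIV"
    and alt0: "\<And>i. i \<le> k \<Longrightarrow> 0 < \<sigma> * (-1) ^ i * coeff q (l0 i)"
    by (rule alternatesE) blast
  \<comment> \<open>From index \<open>r\<close> on, all coefficients of \<open>q\<close> have weakly
    the sign of \<open>e\<close>, so two consecutive alternation indices cannot both be at least
    \<open>r\<close>. Only the last one may be.\<close>
  have below: "l0 i < r" if "i < k" for i
  proof -
    have "l0 i < r" if "i < k" "Suc i = k" for i
    proof (rule ccontr)
      assume "\<not> l0 i < r"
      then have "coeff q (l0 i) * e \<ge> 0" "coeff q (l0 k) * e \<ge> 0"
        using l0[of i k] that q_r q_above[of "l0 i"] q_above[of "l0 k"]
        by (cases "l0 i = r"; force)+
      then show False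
        using alt0[of i] alt0[of k] that e0
        by (auto simp: zero_le_mult_iff zero_less_mult_iff mult_less_0_iff)
    qed
    from this[of "k - 1"] that have "l0 (k - 1) < r" by simp
    moreover have "l0 i \<le> l0 (k - 1)"
    proof (cases "i = k - 1")
      case False
      with that have "i < k - 1" by simp
      then show ?thesis using l0[of i "k - 1"] by simp
    qed simp
    ultimately show ?thesis by simp
  qed
  \<comment> \<open>If the last index exceeds \<open>r\<close>, its coefficient has the same sign as
    the one at \<open>r\<close>, so \<open>r\<close> can replace it. Now all indices lie below
    \<open>c\<close>, where \<open>l - c\<close> is negative, and the alternation carries over to
    \<open>p\<close> with the opposite overall sign.\<close>
  define l where "l = (if l0 k > r then l0(k := r) else l0)"
  have l_le: "l i \<le> r" if "i \<le> k" for i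
    using below[of i] that by (cases "i = k") (auto simp: l_def)
  have l_mono: "l i < l j" if "i < j" "j \<le> k" for i j
    using l0[of i j] below[of i] that by (auto simp: l_def)
  have alt_q: "0 < \<sigma> * (-1) ^ i * coeff q (l i)" if "i \<le> k" for i
  proof (cases "i = k \<and> l0 k > r")
    case True
    then show ?thesis
      using alt0[of k] q_above[of "l0 k"] q_r
      by (auto simp: l_def zero_le_mult_iff zero_less_mult_iff)
  next
    case False
    then show ?thesis using alt0[OF that] by (auto simp: l_def)
  qed
  have alt_p: "0 < - \<sigma> * (-1) ^ i * coeff p (l i)" if "i \<le> k" for i
  proof -
    have "0 < (c - l i) * (- \<sigma> * (-1) ^ i * coeff p (l i))"
      using alt_q[OF that] by (simp add: coeff_q algebra_simps)
    moreover have "c - l i > 0"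
      using l_le[OF that] by (simp add: c_def)
    ultimately show ?thesis by (rule zero_less_mult_pos)
  qed
  \<comment> \<open>The missing index is \<open>degree p\<close> if the sign due next is that of
    \<open>e\<close>, and \<open>r\<close> otherwise. In the second case \<open>l k = r\<close> is
    impossible, since the coefficient at \<open>l k\<close> has the preceding sign.\<close>
  show ?case
  proof (cases "0 < - \<sigma> * (-1) ^ Suc k * e")
    case True
    have "l k < degree p" using l_le[of k] rd by simp
    with True show ?thesis
      unfolding e_def
      by (intro alternates_appendI[where s = "-\<sigma>" and t = l]) (use l_mono alt_p in auto)
  next
    case False
    let ?X = "- \<sigma> * (-1) ^ Suc k"
    have "?X \<noteq> 0" using alt_p[of k] by auto
    with False e0 have "?X * e < 0"
      by (metis mult_eq_0_iff not_less_iff_gr_or_eq)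
    then have "0 < (?X * e) * (coeff p r * e)"
      using r by (rule mult_neg_neg)
    then have "0 < (e * e) * (?X * coeff p r)"
      by (simp only: mult_ac)
    then have pos_r: "0 < ?X * coeff p r"
      by (rule zero_less_mult_pos) (use e0 in \<open>simp flip: power2_eq_square\<close>)
    have "l k \<noteq> r"
    proof
      assume "l k = r"
      then show False using alt_p[of k] pos_r by simp
    qed
    then have "l k < r" using l_le[of k] by simp
    moreover note pos_r
    ultimately show ?thesis
      by (intro alternates_appendI[where s = "-\<sigma>" and t = l]) (use l_mono alt_p in auto)
  qed
qed

text \<open>Descartes' rule gives \<open>k + 1\<close> increasing indices of nonzero coefficients,
  and the last of these is at least \<open>k\<close>.\<close>

lemma alternates_le_degree:
  fixes p :: "real poly"
  assumes "alternates {0<..} (poly p) k"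
  shows "k \<le> degree p" "p \<noteq> 0"
proof -
  obtain t s where t: "\<And>i j. i < j \<Longrightarrow> j \<le> k \<Longrightarrow> t i < t j"
    and "\<And>i. i \<le> k \<Longrightarrow> t i \<in> UNIV"
    and alt: "\<And>i. i \<le> k \<Longrightarrow> 0 < s * (-1) ^ i * coeff p (t i)"
    using descartes_rule_alternates[OF assms] by (rule alternatesE) blast
  have "i \<le> t i" if "i \<le> k" for i
    using that
  proof (induction i)
    case (Suc i)
    with t[of i "Suc i"] show ?case by simp
  qed simp
  then have "k \<le> t k" by simp
  also have "coeff p (t k) \<noteq> 0" using alt[of k] by auto
  then have "t k \<le> degree p" by (rule le_degree)
  finally show "k \<le> degree p" .
  show "p \<noteq> 0" using \<open>coeff p (t k) \<noteq> 0\<close> by auto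
qed

subsection \<open>Homogenization\<close>

definition hom_eval :: "nat \<Rightarrow> 'a::comm_ring_1 poly \<Rightarrow> 'a \<Rightarrow> 'a \<Rightarrow> 'a" where
  "hom_eval N p u v = (\<Sum>i\<le>N. coeff p i * u ^ i * v ^ (N - i))"

lemma hom_eval_0 [simp]: "hom_eval 0 p u v = coeff p 0"
  by (simp add: hom_eval_def)

lemma hom_eval_add: "hom_eval N (p + q) u v = hom_eval N p u v + hom_eval N q u v"
  by (simp add: hom_eval_def algebra_simps sum.distrib)

lemma hom_eval_smult: "hom_eval N (smult c p) u v = c * hom_eval N p u v"
  by (simp add: hom_eval_def sum_distrib_left mult_ac)

lemma hom_eval_linear_mult:
  assumes "degree p \<le> N"
  shows "hom_eval (Suc N) ([:a, b:] * p) u v = (a * v + b * u) * hom_eval N p u v"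
proof -
  have "coeff p (Suc N) = 0"
    using assms by (intro coeff_eq_0) simp
  then have 1: "(\<Sum>i\<le>Suc N. coeff p i * u ^ i * v ^ (Suc N - i)) = v * hom_eval N p u v"
    by (simp add: hom_eval_def sum_distrib_left Suc_diff_le mult_ac)
  have 2: "(\<Sum>i\<le>Suc N. coeff (pCons 0 p) i * u ^ i * v ^ (Suc N - i)) = u * hom_eval N p u v"
    by (subst sum.atMost_Suc_shift) (simp add: hom_eval_def sum_distrib_left mult_ac)
  have "hom_eval (Suc N) ([:a, b:] * p) u v =
      a * (\<Sum>i\<le>Suc N. coeff p i * u ^ i * v ^ (Suc N - i)) +
      b * (\<Sum>i\<le>Suc N. coeff (pCons 0 p) i * u ^ i * v ^ (Suc N - i))"
    unfolding hom_eval_def sum_distrib_left sum.distrib[symmetric]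
    by (intro sum.cong) (simp_all add: algebra_simps coeff_pCons split: nat.splits)
  then show ?thesis
    unfolding 1 2 by (simp add: algebra_simps)
qed

lemma hom_eval_Suc:
  assumes "degree p \<le> N"
  shows "hom_eval (Suc N) p u v = v * hom_eval N p u v"
  using hom_eval_linear_mult[OF assms, of 1 0 u v] by simp

lemma hom_eval_linear_power_mult:
  assumes "degree p \<le> N"
  shows "hom_eval (k + N) ([:a, b:] ^ k * p) u v = (a * v + b * u) ^ k * hom_eval N p u v"
proof (induction k)
  case (Suc k)
  have "degree ([:a, b:] ^ k * p) \<le> degree [:a, b:] * k + degree p"
    by (meson add_mono degree_mult_le degree_power_le le_trans order_refl)
  also have "\<dots> \<le> k + N"
    using assms by (auto split: if_splits)
  finally show ?case
    using hom_eval_linear_mult[of "[:a, b:] ^ k * p" "k + N" a b u v] Suc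
    by (simp add: mult.assoc del: mult_pCons_left)
qed simp

lemma hom_eval_prod_list_linear:
  "hom_eval (length as) (\<Prod>a\<leftarrow>as. [:a, 1:]) u v = (\<Prod>a\<leftarrow>as. u + a * v)"
  and degree_prod_list_linear: "degree (\<Prod>a\<leftarrow>as. [:a, 1 :: 'a::comm_ring_1:]) \<le> length as"
proof (induction as)
  case (Cons a as)
  show "hom_eval (length (a # as)) (\<Prod>a\<leftarrow>a # as. [:a, 1:]) u v = (\<Prod>a\<leftarrow>a # as. u + a * v)"
    using hom_eval_linear_mult[OF Cons(2), of a 1 u v] Cons(1) by (simp add: add_ac)
  have "degree ([:a, 1:] * (\<Prod>a\<leftarrow>as. [:a, 1:])) \<le> degree [:a, 1:] + degree (\<Prod>a\<leftarrow>as. [:a, 1:])"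
    by (rule degree_mult_le)
  with Cons(2) show "degree (\<Prod>a\<leftarrow>a # as. [:a, 1:]) \<le> length (a # as)"
    by simp
qed auto

lemma hom_eval_eq_poly:
  fixes v :: "'a::field"
  assumes "degree p \<le> N" "v \<noteq> 0"
  shows "hom_eval N p u v = v ^ N * poly p (u / v)"
proof -
  have "poly p (u / v) = (\<Sum>i\<le>N. coeff p i * (u / v) ^ i)"
    unfolding poly_altdef using assms(1)
    by (intro sum.mono_neutral_left) (auto simp: coeff_eq_0)
  then show ?thesis
    using assms(2)
    by (auto simp: hom_eval_def sum_distrib_left power_divide power_diff intro!: sum.cong)
qed

lemma hom_eval_reflect_poly:
  "hom_eval (degree p) (reflect_poly p) u v = hom_eval (degree p) p v u"
  unfolding hom_eval_def
  by (rule sum.reindex_bij_witness[of _ "\<lambda>i. degree p - i" "\<lambda>i. degree p - i"])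
     (auto simp: coeff_reflect_poly)

lemma hom_eval_of_real:
  "hom_eval N (map_poly of_real p) (of_real u) (of_real v :: 'a::{real_algebra_1,comm_ring_1}) =
     of_real (hom_eval N p u v)"
  by (simp add: hom_eval_def coeff_map_poly)

text \<open>Up to a nonnegative factor, \<open>coeff p l\<close> is the value of \<open>f\<close> at
  \<open>(l + 1) / (m + 1 - l)\<close>, which increases with \<open>l\<close>. Descartes' rule for
  \<open>p\<close> thus yields an alternation of \<open>f\<close> at these sample points. This is
  how the inverse of \<Phi> is seen not to create sign changes.\<close>

lemma hom_eval_alternates:
  assumes "degree f \<le> N" "degree p \<le> m" "\<And>l. w l \<ge> 0"
    and "\<And>l. l \<le> m \<Longrightarrow> coeff p l = w l * hom_eval N f (real (l + 1)) (real (m + 1 - l))"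
    and "alternates {0<..} (poly p) k"
  shows "alternates {0<..} (poly f) k"
proof -
  obtain t s where t: "\<And>i j. i < j \<Longrightarrow> j \<le> k \<Longrightarrow> t i < t j"
    and "\<And>i. i \<le> k \<Longrightarrow> t i \<in> UNIV"
    and alt: "\<And>i. i \<le> k \<Longrightarrow> 0 < s * (-1) ^ i * coeff p (t i)"
    using descartes_rule_alternates[OF assms(5)] by (rule alternatesE) blast
  have t_le: "t i \<le> m" if "i \<le> k" for i
    using alt[OF that] assms(2) le_degree[of p "t i"] by fastforce
  define u where "u i = real (t i + 1) / real (m + 1 - t i)" for i
  show ?thesis
  proof (rule alternatesI)
    show "u i < u (Suc i)" if "i < k" for i
    proof -
      have "t i < t (Suc i)" "t (Suc i) \<le> m"
        using t[of i "Suc i"] t_le[of "Suc i"] that by auto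
      then show ?thesis
        unfolding u_def by (intro frac_less) auto
    qed
    show "u i \<in> {0<..}" if "i \<le> k" for i
      using t_le[OF that] by (simp add: u_def)
    show "0 < s * (-1) ^ i * poly f (u i)" if "i \<le> k" for i
    proof -
      let ?W = "w (t i) * real (m + 1 - t i) ^ N"
      have "coeff p (t i) = w (t i) * (real (m + 1 - t i) ^ N * poly f (u i))"
        using t_le[OF that] assms(4)[OF t_le[OF that]] hom_eval_eq_poly[OF assms(1)]
        by (simp add: u_def)
      then have "0 < ?W * (s * (-1) ^ i * poly f (u i))"
        using alt[OF that] by (simp add: mult_ac)
      moreover have "?W \<ge> 0"
        using assms(3) by simp
      ultimately show ?thesis
        by (metis mult_le_0_iff not_le)
    qed
  qed
qed

subsection \<open>The inverse of \<open>\<Phi>\<close>\<close>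

text \<open>The argument is the cofactor \<open>S\<close> of \<open>(x + 1) S\<close>, whereas the
  value is the full polynomial, with its factor \<open>x + 1\<close>.\<close>

definition Psi :: "nat \<Rightarrow> complex poly \<Rightarrow> complex poly" where
  "Psi n S = (\<Sum>k\<le>n. monom (of_nat (n choose k) *
     hom_eval (n - 1) S (of_nat k) (of_nat (n - k)) / of_nat n ^ (n - 1)) k)"

lemma coeff_sum_monom: "coeff (\<Sum>k\<le>n. monom (f k) k) l = (if l \<le> n then f l else 0)"
  by (simp add: coeff_sum)

lemma coeff_Psi:
  "coeff (Psi n S) k = of_nat (n choose k) *
     hom_eval (n - 1) S (of_nat k) (of_nat (n - k)) / of_nat n ^ (n - 1)"
  unfolding Psi_def coeff_sum_monom by simp

lemma Psi_add: "Psi n (S + T) = Psi n S + Psi n T"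
  by (rule poly_eqI) (simp add: coeff_Psi hom_eval_add field_simps add_divide_distrib)

lemma Psi_smult: "Psi n (smult c S) = smult c (Psi n S)"
  by (rule poly_eqI) (simp add: coeff_Psi hom_eval_smult)

lemma Psi_0: "Psi n 0 = 0"
  using Psi_smult[of n 0 0] by simp

lemma Psi_sum: "Psi n (\<Sum>i\<in>I. f i) = (\<Sum>i\<in>I. Psi n (f i))"
  by (induction I rule: infinite_finite_induct) (simp_all add: Psi_0 Psi_add)

section \<open>Coefficients of Schur-Szego compositions of the \<open>K n a\<close>\<close>

lemma coeff_one_plus_power: "coeff ([:1, 1:] ^ n :: 'a::comm_semiring_1 poly) k = of_nat (n choose k)"
proof (cases "k \<le> n")
  case False
  have "degree ([:1, 1:] ^ n :: 'a poly) < k"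
    using False degree_power_le[of "[:1, 1:] :: 'a poly" n] by (auto split: if_splits)
  then show ?thesis using False by (simp add: coeff_eq_0 binomial_eq_0)
qed (simp add: coeff_linear_poly_power)

text \<open>The two absorption identities for binomial coefficients express both summands through
  \<open>n choose k\<close>. After division by \<open>n choose k\<close> the composition is
  coefficientwise multiplication, so each \<open>K n a\<close> contributes one linear form in
  \<open>k\<close> and \<open>n - k\<close>.\<close>

lemma coeff_K:
  assumes "n \<ge> 1" "k \<le> n"
  shows "coeff (K n a) k / of_nat (n choose k) = (of_nat k + a * of_nat (n - k)) / of_nat n"
proof -
  obtain m where n: "n = Suc m" using assms(1) by (cases n) auto
  have "of_nat n * coeff (K n a) k = of_nat (n choose k) * (of_nat k + a * of_nat (n - k))"
  proof (cases k)
    case 0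
    then show ?thesis by (simp add: K_def n coeff_one_plus_power)
  next
    case (Suc l)
    have "of_nat (Suc m) * of_nat (m choose l) = (of_nat (Suc l) * of_nat (Suc m choose Suc l) :: complex)"
      by (metis Suc_times_binomial of_nat_mult)
    moreover have "of_nat (Suc m) * of_nat (m choose Suc l) =
        (of_nat (Suc m - Suc l) * of_nat (Suc m choose Suc l) :: complex)"
      by (metis binomial_absorb_comp diff_Suc_1 of_nat_mult)
    ultimately show ?thesis
      by (simp add: K_def n coeff_one_plus_power Suc algebra_simps del: of_nat_Suc binomial_Suc_Suc)
  qed
  then show ?thesis
    using assms by (simp add: field_simps)
qed

lemma coeff_schur_szego:
  "coeff (schur_szego n P Q) k = (if k \<le> n then coeff P k * coeff Q k / of_nat (n choose k) else 0)"
  unfolding schur_szego_def coeff_sum_monom ..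

lemma coeff_schur_szego_list_K:
  assumes "n \<ge> 1"
  shows "coeff (schur_szego_list n (map (K n) as)) k =
    of_nat (n choose k) * (\<Prod>a\<leftarrow>as. of_nat k + a * of_nat (n - k)) / of_nat n ^ length as"
proof (cases "k \<le> n")
  case True
  then show ?thesis
  proof (induction as)
    case Nil
    then show ?case by (simp add: schur_szego_list_def coeff_linear_poly_power)
  next
    case (Cons a as)
    have "coeff (schur_szego_list n (map (K n) (a # as))) k =
        (coeff (K n a) k / of_nat (n choose k)) * coeff (schur_szego_list n (map (K n) as)) k"
      using True by (simp add: schur_szego_list_def coeff_schur_szego)
    then show ?case
      by (simp add: coeff_K[OF assms True] Cons)
  qed
next
  case False
  then show ?thesis
    by (cases as) (simp_all add: schur_szego_list_def coeff_schur_szego coeff_one_plus_power binomial_eq_0)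
qed

text \<open>The product of the linear forms \<open>k + a (n - k)\<close> is the homogenization of
  the product of the \<open>x + a\<close> at \<open>(k, n - k)\<close>; this explains the formula
  for \<open>Psi\<close>.\<close>

lemma Psi_prod_linear:
  assumes "n \<ge> 1" "length as = n - 1"
  shows "Psi n (\<Prod>a\<leftarrow>as. [:a, 1:]) = schur_szego_list n (map (K n) as)"
  by (rule poly_eqI)
     (simp add: coeff_Psi coeff_schur_szego_list_K[OF assms(1)] assms(2)
        hom_eval_prod_list_linear[of as, unfolded assms(2)] del: One_nat_def)

text \<open>The summands vanish at -1 to pairwise different orders. Matching the value at -1 with
  the top \<open>F\<close> leaves a multiple of \<open>x + 1\<close>, and the quotient has smaller
  degree.\<close>

lemma poly_basis_linear_powers:
  fixes R :: "'a::field poly"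
  assumes "\<And>i. poly (F i) (-1) \<noteq> 0" "\<And>i. degree (F i) \<le> i" "degree R \<le> N"
  shows "\<exists>r. R = (\<Sum>i\<le>N. smult (r i) (F i * [:1, 1:] ^ (N - i)))"
  using assms(3)
proof (induction N arbitrary: R)
  case 0
  obtain a where R: "R = [:a:]" using 0 by (auto elim: degree_eq_zeroE)
  obtain b where b: "F 0 = [:b:]" using assms(2)[of 0] by (auto elim: degree_eq_zeroE)
  have "b \<noteq> 0" using assms(1)[of 0] b by simp
  then show ?case
    by (intro exI[of _ "\<lambda>_. a / b"]) (simp add: R b)
next
  case (Suc N)
  define c where "c = poly R (-1) / poly (F (Suc N)) (-1)"
  have "poly (R - smult c (F (Suc N))) (-1) = 0"
    using assms(1) by (simp add: c_def)
  then have "[:1, 1:] dvd R - smult c (F (Suc N))"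
    using poly_eq_0_iff_dvd[of "R - smult c (F (Suc N))" "-1"] by simp
  then obtain T where T: "R - smult c (F (Suc N)) = [:1, 1:] * T"
    by (rule dvdE)
  have "degree (R - smult c (F (Suc N))) \<le> Suc N"
    using Suc.prems assms(2) by (intro degree_diff_le) (auto intro: order.trans[OF degree_smult_le])
  then have "degree T \<le> N"
    unfolding T by (cases "T = 0") (simp_all add: degree_mult_eq del: mult_pCons_left)
  then obtain r where r: "T = (\<Sum>i\<le>N. smult (r i) (F i * [:1, 1:] ^ (N - i)))"
    using Suc.IH by blast
  have "R = smult c (F (Suc N)) + [:1, 1:] * T"
    using T by (simp add: algebra_simps)
  also have "[:1, 1:] * T = (\<Sum>i\<le>N. smult (r i) (F i * [:1, 1:] ^ (Suc N - i)))"
    unfolding r sum_distrib_left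
    by (intro sum.cong) (simp_all add: Suc_diff_le mult_ac del: mult_pCons_left mult_pCons_right)
  finally show ?case
    by (intro exI[of _ "r(Suc N := c)"]) (simp add: add.commute)
qed

text \<open>The homogenization of this polynomial takes the value
  \<open>n\<^sup>i k (k - 1) \<dots> (k - i + 1)\<close> at \<open>(k, n - k)\<close>.\<close>

definition falling_poly :: "nat \<Rightarrow> nat \<Rightarrow> complex poly" where
  "falling_poly n i = (\<Prod>t<i. [:- of_nat t, of_nat n - of_nat t:])"

lemma poly_falling_poly: "poly (falling_poly n i) (-1) = (- of_nat n) ^ i"
  by (simp add: falling_poly_def poly_prod)

lemma falling_poly:
  shows degree_falling_poly: "degree (falling_poly n i) \<le> i"
    and hom_eval_falling_poly: "k \<le> n \<Longrightarrow>
      hom_eval i (falling_poly n i) (of_nat k) (of_nat (n - k)) = of_nat n ^ i * (fact i * of_nat (k choose i))"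
proof -
  have "degree (falling_poly n i) \<le> i \<and> (k \<le> n \<longrightarrow>
      hom_eval i (falling_poly n i) (of_nat k) (of_nat (n - k)) = of_nat n ^ i * (\<Prod>t<i. of_nat k - of_nat t))"
  proof (induction i)
    case 0
    then show ?case by (simp add: falling_poly_def)
  next
    case (Suc i)
    have eq: "falling_poly n (Suc i) = [:- of_nat i, of_nat n - of_nat i:] * falling_poly n i"
      by (simp add: falling_poly_def mult.commute)
    have "degree (falling_poly n (Suc i)) \<le> degree [:- of_nat i, of_nat n - of_nat i :: complex:] + degree (falling_poly n i)"
      unfolding eq by (rule degree_mult_le)
    also have "\<dots> \<le> 1 + i"
      using Suc by (intro add_mono) auto
    finally have "degree (falling_poly n (Suc i)) \<le> Suc i" by simp
    moreover have "hom_eval (Suc i) (falling_poly n (Suc i)) (of_nat k) (of_nat (n - k)) =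
        of_nat n ^ Suc i * (\<Prod>t<Suc i. of_nat k - of_nat t)" if "k \<le> n"
    proof -
      have "- of_nat i * of_nat (n - k) + (of_nat n - of_nat i) * of_nat k =
          (of_nat n * (of_nat k - of_nat i) :: complex)"
        using that by (simp add: of_nat_diff algebra_simps)
      then show ?thesis
        unfolding eq using Suc that hom_eval_linear_mult[of "falling_poly n i" i]
        by (simp del: mult_pCons_left)
    qed
    ultimately show ?case by blast
  qed
  moreover have "(\<Prod>t<i. of_nat k - of_nat t) = (fact i * of_nat (k choose i) :: complex)"
    by (simp add: binomial_gbinomial gbinomial_prod_rev atLeast0LessThan)
  ultimately show "degree (falling_poly n i) \<le> i"
    and "k \<le> n \<Longrightarrow>
      hom_eval i (falling_poly n i) (of_nat k) (of_nat (n - k)) = of_nat n ^ i * (fact i * of_nat (k choose i))"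
    by auto
qed

text \<open>\<open>Psi\<close> carries one basis to nonzero multiples of another, because \<open>(n
  choose k) (k choose i) = (n choose i) ((n - i) choose (k - i))\<close>. For \<open>i < n\<close>
  the image is divisible by \<open>x + 1\<close>, so both the range and the surjectivity of
  \<open>Psi\<close> can be read off.\<close>

lemma Psi_falling_poly:
  assumes "i < n"
  shows "Psi n (falling_poly n i * [:1, 1:] ^ (n - 1 - i)) =
    smult (fact i * of_nat (n choose i)) (monom 1 i * [:1, 1:] ^ (n - i))"
proof (rule poly_eqI)
  fix k
  show "coeff (Psi n (falling_poly n i * [:1, 1:] ^ (n - 1 - i))) k =
    coeff (smult (fact i * of_nat (n choose i)) (monom 1 i * [:1, 1:] ^ (n - i))) k"
  proof (cases "k \<le> n")
    case False
    then show ?thesis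
      using assms by (simp add: coeff_Psi coeff_monom_mult coeff_one_plus_power binomial_eq_0)
  next
    case True
    have "hom_eval (n - 1 - i + i) ([:1, 1:] ^ (n - 1 - i) * falling_poly n i) (of_nat k) (of_nat (n - k)) =
        of_nat n ^ (n - 1 - i) * (of_nat n ^ i * (fact i * of_nat (k choose i)))"
      unfolding hom_eval_linear_power_mult[OF degree_falling_poly] hom_eval_falling_poly[OF True]
      using True by (simp add: of_nat_diff)
    moreover have e: "n - 1 - i + i = n - 1" using assms by simp
    moreover have "of_nat n ^ (n - 1 - i) * of_nat n ^ i = (of_nat n ^ (n - 1) :: complex)"
      by (simp only: e flip: power_add)
    ultimately have "hom_eval (n - 1) (falling_poly n i * [:1, 1:] ^ (n - 1 - i)) (of_nat k) (of_nat (n - k)) =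
        of_nat n ^ (n - 1) * (fact i * of_nat (k choose i))"
      unfolding mult.commute[of "falling_poly n i"] by (simp only: flip: mult.assoc)
    then have "coeff (Psi n (falling_poly n i * [:1, 1:] ^ (n - 1 - i))) k =
        fact i * of_nat ((n choose k) * (k choose i))"
      using assms by (simp add: coeff_Psi)
    also have "(n choose k) * (k choose i) = (n choose i) * (if k < i then 0 else (n - i) choose (k - i))"
      using True by (simp add: choose_mult)
    finally show ?thesis
      by (simp add: coeff_monom_mult coeff_one_plus_power)
  qed
qed

lemma linear_mult_in_polys_vanishing:
  assumes "degree S \<le> n - 1" "n \<ge> 1"
  shows "[:1, 1:] * S \<in> polys_vanishing n"
proof -
  have "degree ([:1, 1:] * S) \<le> degree [:1, 1 :: complex:] + degree S"
    by (rule degree_mult_le)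
  then show ?thesis
    using assms unfolding polys_vanishing_def by simp
qed

lemma polys_vanishingE:
  assumes "P \<in> polys_vanishing n" "n \<ge> 1"
  obtains S where "degree S \<le> n - 1" "P = [:1, 1:] * S"
proof -
  have "[:1, 1:] dvd P"
    using assms(1) poly_eq_0_iff_dvd[of P "-1"] by (simp add: polys_vanishing_def)
  then obtain S where S: "P = [:1, 1:] * S" by (rule dvdE)
  have "degree S \<le> n - 1"
    using assms by (cases "S = 0") (auto simp: S polys_vanishing_def degree_mult_eq simp del: mult_pCons_left)
  with S that show thesis by blast
qed

lemma Psi_falling_sum:
  assumes "n \<ge> 1"
  shows "Psi n (\<Sum>i\<le>n - 1. smult (r i) (falling_poly n i * [:1, 1:] ^ (n - 1 - i))) =
    [:1, 1:] * (\<Sum>i\<le>n - 1. smult (r i * (fact i * of_nat (n choose i))) (monom 1 i * [:1, 1:] ^ (n - 1 - i)))"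
  unfolding Psi_sum Psi_smult sum_distrib_left
proof (intro sum.cong refl)
  fix i assume "i \<in> {..n - 1}"
  then have "i < n" using assms by auto
  then have "n - i = Suc (n - 1 - i)" by simp
  then show "smult (r i) (Psi n (falling_poly n i * [:1, 1:] ^ (n - 1 - i))) =
      [:1, 1:] * smult (r i * (fact i * of_nat (n choose i))) (monom 1 i * [:1, 1:] ^ (n - 1 - i))"
    using Psi_falling_poly[OF \<open>i < n\<close>] by (simp add: mult_ac del: mult_pCons_left mult_pCons_right)
qed

lemma degree_basis_sum:
  assumes "\<And>i. degree (F i) \<le> i"
  shows "degree (\<Sum>i\<le>N. smult (r i) (F i * [:1, 1 :: 'a::comm_ring_1:] ^ (N - i))) \<le> N"
proof (rule degree_sum_le)
  fix i assume i: "i \<in> {..N}"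
  have "degree (smult (r i) (F i * [:1, 1:] ^ (N - i))) \<le> degree (F i) + degree ([:1, 1 :: 'a:] ^ (N - i))"
    by (meson degree_mult_le degree_smult_le le_trans)
  also have "\<dots> \<le> i + (N - i)"
    using assms degree_power_le[of "[:1, 1 :: 'a:]" "N - i"] by (intro add_mono) auto
  finally show "degree (smult (r i) (F i * [:1, 1:] ^ (N - i))) \<le> N" using i by simp
qed simp

lemma Psi_in_polys_vanishing:
  assumes "n \<ge> 1" "degree S \<le> n - 1"
  shows "Psi n S \<in> polys_vanishing n"
proof -
  obtain r where "S = (\<Sum>i\<le>n - 1. smult (r i) (falling_poly n i * [:1, 1:] ^ (n - 1 - i)))"
    using poly_basis_linear_powers[of "falling_poly n" S "n - 1"] assms degree_falling_poly
    by (auto simp: poly_falling_poly)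
  then have "Psi n S = [:1, 1:] *
      (\<Sum>i\<le>n - 1. smult (r i * (fact i * of_nat (n choose i))) (monom 1 i * [:1, 1:] ^ (n - 1 - i)))"
    using Psi_falling_sum[OF assms(1)] by blast
  also have "\<dots> \<in> polys_vanishing n"
    using assms(1) by (intro linear_mult_in_polys_vanishing degree_basis_sum) (simp_all add: degree_monom_eq)
  finally show ?thesis .
qed

lemma Psi_surj:
  assumes "n \<ge> 1" "P \<in> polys_vanishing n"
  obtains S where "degree S \<le> n - 1" "Psi n S = P"
proof -
  obtain R where R: "degree R \<le> n - 1" "P = [:1, 1:] * R"
    using polys_vanishingE[OF assms(2,1)] .
  obtain r where r: "R = (\<Sum>i\<le>n - 1. smult (r i) (monom 1 i * [:1, 1:] ^ (n - 1 - i)))"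
    using poly_basis_linear_powers[of "\<lambda>i. monom 1 i" R "n - 1"] R(1)
    by (auto simp: poly_monom degree_monom_eq)
  define q where "q i = r i / (fact i * of_nat (n choose i))" for i
  define S where "S = (\<Sum>i\<le>n - 1. smult (q i) (falling_poly n i * [:1, 1:] ^ (n - 1 - i)))"
  show thesis
  proof
    show "degree S \<le> n - 1"
      unfolding S_def by (rule degree_basis_sum) (rule degree_falling_poly)
    have "(\<Sum>i\<le>n - 1. smult (q i * (fact i * of_nat (n choose i))) (monom 1 i * [:1, 1:] ^ (n - 1 - i))) = R"
      unfolding r by (intro sum.cong) (use assms in \<open>auto simp: q_def\<close>)
    then show "Psi n S = P"
      unfolding S_def Psi_falling_sum[OF assms(1)] R(2) by simp
  qed
qed

lemma monic_split:
  fixes S :: "complex poly"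
  assumes "S \<noteq> 0"
  obtains as where "length as = degree S" "S = smult (lead_coeff S) (\<Prod>a\<leftarrow>as. [:a, 1:])"
proof -
  obtain M where M: "size M = degree S" "S = smult (lead_coeff S) (\<Prod>x\<in>#M. [:- x, 1:])"
    using alg_closed_imp_factorization[OF assms] by blast
  obtain xs where xs: "mset xs = M" using ex_mset by blast
  show thesis
  proof
    show "length (map uminus xs) = degree S" using M(1) xs by auto
    show "S = smult (lead_coeff S) (\<Prod>a\<leftarrow>map uminus xs. [:a, 1:])"
      using M(2) unfolding xs[symmetric] by (simp add: prod_mset_prod_list[symmetric] comp_def flip: mset_map)
  qed
qed

text \<open>For a monic product of \<open>n - 1\<close> linear factors this is the defining property
  of \<Phi>. Homogeneity and the fundamental theorem of algebra extend it to all \<open>S\<close> of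
  exact degree \<open>n - 1\<close>, additivity to the rest.\<close>

lemma Phi_Psi:
  assumes "is_Phi n \<Phi>" "n \<ge> 1" "degree S \<le> n - 1"
  shows "\<Phi> (Psi n S) = [:1, 1:] * S"
proof -
  have full: "\<Phi> (Psi n T) = [:1, 1:] * T" if T: "degree T = n - 1" "T \<noteq> 0" for T
  proof -
    obtain as where as: "length as = degree T" "T = smult (lead_coeff T) (\<Prod>a\<leftarrow>as. [:a, 1:])"
      using monic_split[OF T(2)] .
    have "\<Phi> (Psi n (smult c (\<Prod>a\<leftarrow>as. [:a, 1:]))) = [:1, 1:] * smult c (\<Prod>a\<leftarrow>as. [:a, 1:])" for c
    proof -
      have l: "length as = n - 1" using as T by simp
      have "Psi n (\<Prod>a\<leftarrow>as. [:a, 1:]) \<in> polys_vanishing n"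
        using Psi_in_polys_vanishing[OF assms(2)] degree_prod_list_linear[of as] l by simp
      then have "\<Phi> (Psi n (smult c (\<Prod>a\<leftarrow>as. [:a, 1:]))) = smult c (\<Phi> (Psi n (\<Prod>a\<leftarrow>as. [:a, 1:])))"
        using assms(1) unfolding Psi_smult is_Phi_def by blast
      also have "\<Phi> (Psi n (\<Prod>a\<leftarrow>as. [:a, 1:])) = [:1, 1:] * (\<Prod>a\<leftarrow>as. [:a, 1:])"
        using assms(1) l unfolding is_Phi_def Psi_prod_linear[OF assms(2) l] by blast
      finally show ?thesis by (simp only: mult_smult_right)
    qed
    with as(2) show ?thesis by metis
  qed
  show ?thesis
  proof (cases "degree S = n - 1 \<and> S \<noteq> 0")
    case False
    \<comment> \<open>Adding \<open>x^(n - 1)\<close> to a polynomial of lower degree brings it into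
      the case already settled; the contribution of \<open>M\<close> is then cancelled.\<close>
    define M :: "complex poly" where "M = monom 1 (n - 1)"
    have M: "degree M = n - 1" "M \<noteq> 0" by (simp_all add: M_def degree_monom_eq)
    have "coeff S (n - 1) = 0"
      using False assms(3) by (metis coeff_eq_0 le_neq_implies_less coeff_0)
    then have c: "coeff (S + M) (n - 1) = 1" by (simp add: M_def)
    have "S + M \<noteq> 0"
    proof
      assume "S + M = 0"
      then show False using c by (simp only: coeff_0) simp
    qed
    moreover have "degree (S + M) \<le> n - 1" using assms(3) M by (intro degree_add_le) auto
    moreover have "n - 1 \<le> degree (S + M)" using c by (intro le_degree) (simp only: c one_neq_zero not_False_eq_True)
    ultimately have "\<Phi> (Psi n (S + M)) = [:1, 1:] * (S + M)" by (intro full) auto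
    moreover have "\<Phi> (Psi n S + Psi n M) = \<Phi> (Psi n S) + \<Phi> (Psi n M)"
      using assms(1) Psi_in_polys_vanishing[OF assms(2,3)] Psi_in_polys_vanishing[OF assms(2), of M] M
      unfolding is_Phi_def by simp
    ultimately have "\<Phi> (Psi n S) + [:1, 1:] * M = [:1, 1:] * S + [:1, 1:] * M"
      by (simp only: Psi_add full[OF M] distrib_left)
    then show ?thesis by (simp only: add_right_cancel)
  qed (use full in blast)
qed

text \<open>Writing an eigenvector as \<open>Psi n U\<close> and applying \<Phi> gives
  \<open>U = smult \<mu> S\<close>, so the eigenvalue equation for \<Phi> becomes an explicit one
  for \<open>Psi\<close>.\<close>

lemma eigenspace_iff_Psi:
  assumes "is_Phi n \<Phi>" "n \<ge> 1" "degree S \<le> n - 1" "\<mu> \<noteq> 0"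
  shows "[:1, 1:] * S \<in> eigenspace n \<Phi> \<mu> \<longleftrightarrow> [:1, 1:] * S = smult \<mu> (Psi n S)"
proof
  assume ev: "[:1, 1:] * S \<in> eigenspace n \<Phi> \<mu>"
  then have "[:1, 1:] * S \<in> polys_vanishing n" by (simp only: eigenspace_def mem_Collect_eq)
  then obtain U where U: "degree U \<le> n - 1" "Psi n U = [:1, 1:] * S"
    by (rule Psi_surj[OF assms(2)])
  have "[:1, 1:] * U = smult \<mu> ([:1, 1:] * S)"
    using ev Phi_Psi[OF assms(1,2) U(1)] unfolding U(2) eigenspace_def by simp
  then have "[:1, 1:] * U = [:1, 1:] * smult \<mu> S"
    by (simp only: mult_smult_right)
  then have "U = smult \<mu> S"
    by (subst (asm) mult_cancel_left) simp
  with U(2) show "[:1, 1:] * S = smult \<mu> (Psi n S)"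
    by (simp only: Psi_smult)
next
  assume eq: "[:1, 1:] * S = smult \<mu> (Psi n S)"
  have "\<Phi> (smult \<mu> (Psi n S)) = smult \<mu> (\<Phi> (Psi n S))"
    using assms(1) Psi_in_polys_vanishing[OF assms(2,3)] unfolding is_Phi_def by blast
  then show "[:1, 1:] * S \<in> eigenspace n \<Phi> \<mu>"
    using linear_mult_in_polys_vanishing[OF assms(3,2)] Phi_Psi[OF assms(1-3)]
    unfolding eigenspace_def by (simp flip: eq del: mult_pCons_left)
qed

subsection \<open>Eigenfunctions of the Bernstein operator\<close>

text \<open>In the variable \<open>y = x / (1 + x)\<close> this says that \<open>y (1 - y) (1 - y)\<^sup>j Q(x)\<close> is an
  eigenfunction of the Bernstein operator of order \<open>m + 2\<close>.\<close>

definition bernstein_eigen :: "nat \<Rightarrow> nat \<Rightarrow> 'a::comm_ring_1 \<Rightarrow> 'a poly \<Rightarrow> bool" where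
  "bernstein_eigen m j \<kappa> Q \<longleftrightarrow> (\<forall>l\<le>m. coeff ([:1, 1:] ^ (m - j) * Q) l =
     \<kappa> * of_nat (m choose l) * hom_eval j Q (of_nat (l + 1)) (of_nat (m + 1 - l)))"

lemma degree_one_plus_power_mult:
  fixes Q :: "'a::comm_ring_1 poly"
  shows "degree Q \<le> j \<Longrightarrow> degree ([:1, 1:] ^ d * Q) \<le> d + j"
  using degree_mult_le[of "[:1, 1:] ^ d" Q] degree_power_le[of "[:1, 1 :: 'a:]" d] by simp

lemma binomial_two_step:
  assumes "l \<le> m"
  shows "of_nat (Suc (Suc m) choose Suc l) * (of_nat (Suc l) * of_nat (Suc m - l)) =
    (of_nat (Suc (Suc m)) * of_nat (Suc m) * of_nat (m choose l) :: 'a::comm_semiring_1)"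
proof -
  have "(Suc (Suc m) choose Suc l) * (Suc l * (Suc m - l)) = (Suc m - l) * (Suc l * (Suc (Suc m) choose Suc l))"
    by (simp only: mult_ac)
  also have "\<dots> = Suc (Suc m) * ((Suc m - l) * (Suc m choose l))"
    by (simp only: Suc_times_binomial mult_ac)
  also have "\<dots> = Suc (Suc m) * (Suc m * (m choose l))"
    by (simp only: binomial_absorb_comp diff_Suc_1)
  finally show ?thesis by (simp only: mult.assoc flip: of_nat_mult)
qed

text \<open>Coefficients of \<open>(x + 1) S = smult \<mu> (Psi n S)\<close> are compared for
  \<open>S = x (x + 1)^d Q\<close> with \<open>d = n - 3 - j\<close>. The coefficient at
  \<open>l + 1\<close> gives the condition at \<open>l\<close>, and those at \<open>0\<close> and
  from \<open>n\<close> on vanish on both sides.\<close>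

lemma eigenspace_iff_bernstein_eigen:
  assumes "is_Phi n \<Phi>" "j + 3 \<le> n" "degree Q \<le> j" "\<mu> \<noteq> 0"
  shows "[:0, 1:] * [:1, 1:] ^ (n - 2 - j) * Q \<in> eigenspace n \<Phi> \<mu> \<longleftrightarrow>
    bernstein_eigen (n - 2) j (\<mu> * of_nat (n - 1) / of_nat n ^ (j + 1)) Q"
proof -
  obtain d where "n = j + 3 + d" using le_Suc_ex[OF assms(2)] by blast
  then have n: "n = d + j + 3" by simp
  define m where "m = d + j + 1"
  have nm: "n = Suc (Suc m)" by (simp add: n m_def)
  define T where "T = [:1, 1:] ^ d * Q"
  have deg_T: "degree T \<le> d + j"
    unfolding T_def by (rule degree_one_plus_power_mult[OF assms(3)])
  define S where "S = [:0, 1:] * T"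
  have deg_S: "degree S \<le> n - 1"
    using degree_mult_le[of "[:0, 1:]" T] deg_T by (simp add: S_def n)
  have P: "[:0, 1:] * [:1, 1:] ^ (n - 2 - j) * Q = [:1, 1:] * S"
    by (simp add: S_def T_def n mult_ac del: mult_pCons_left mult_pCons_right)
  \<comment> \<open>The factor \<open>u\<close> comes from \<open>x\<close>. The factor
    \<open>v\<close> appears because \<open>S\<close> has degree at most \<open>n - 2\<close> but is
    homogenized in degree \<open>n - 1\<close>. At \<open>(k, n - k)\<close> the factor
    \<open>(u + v)^d\<close> is the constant \<open>n^d\<close>.\<close>
  have hom: "hom_eval (n - 1) S u v = u * (v * ((u + v) ^ d * hom_eval j Q u v))" for u v
  proof -
    have "hom_eval (Suc (Suc (d + j))) S u v = u * hom_eval (Suc (d + j)) T u v"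
      unfolding S_def using hom_eval_linear_mult[of T "Suc (d + j)" 0 1 u v] deg_T by simp
    also have "hom_eval (Suc (d + j)) T u v = v * hom_eval (d + j) T u v"
      by (rule hom_eval_Suc[OF deg_T])
    also have "hom_eval (d + j) T u v = (u + v) ^ d * hom_eval j Q u v"
      unfolding T_def hom_eval_linear_power_mult[OF assms(3)] by (simp add: add.commute)
    finally show ?thesis by (simp add: n)
  qed
  have key: "\<mu> * coeff (Psi n S) (Suc l) = \<mu> * of_nat (n - 1) / of_nat n ^ (j + 1) *
      of_nat (m choose l) * hom_eval j Q (of_nat (l + 1)) (of_nat (m + 1 - l))" if "l \<le> m" for l
  proof -
    have e: "of_nat (Suc l) + of_nat (n - Suc l) = (of_nat n :: complex)"
      using that unfolding nm of_nat_add[symmetric] by (intro arg_cong[of _ _ of_nat]) simp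
    have "n - Suc l = Suc m - l" by (simp add: nm)
    then have "coeff (Psi n S) (Suc l) = (of_nat (n choose Suc l) * (of_nat (Suc l) * of_nat (Suc m - l))) *
        of_nat n ^ d * hom_eval j Q (of_nat (Suc l)) (of_nat (Suc m - l)) / of_nat n ^ (n - 1)"
      unfolding coeff_Psi hom e by (simp only: mult_ac)
    also have "of_nat (n choose Suc l) * (of_nat (Suc l) * of_nat (Suc m - l)) =
        (of_nat n * of_nat (n - 1) * of_nat (m choose l) :: complex)"
      unfolding nm binomial_two_step[OF that] by simp
    \<comment> \<open>Here \<open>n^d\<close> cancels the power from \<open>(u + v)^d\<close> and
      one \<open>n\<close> cancels the one from the binomial identity, leaving
      \<open>n^(j + 1)\<close>.\<close>
    also have "(of_nat n :: complex) ^ (n - 1) = of_nat n ^ d * of_nat n * of_nat n ^ (j + 1)"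
      by (simp add: n power_add mult_ac)
    finally show ?thesis
      by (simp add: field_simps nm del: of_nat_Suc)
  qed
  have coeff_P: "coeff ([:1, 1:] * S) (Suc l) = coeff ([:1, 1:] ^ (m - j) * Q) l" for l
    unfolding P[symmetric] by (simp add: n m_def mult.assoc)
  have "[:1, 1:] * S = smult \<mu> (Psi n S) \<longleftrightarrow>
    bernstein_eigen m j (\<mu> * of_nat (n - 1) / of_nat n ^ (j + 1)) Q"
  proof
    assume "[:1, 1:] * S = smult \<mu> (Psi n S)"
    then show "bernstein_eigen m j (\<mu> * of_nat (n - 1) / of_nat n ^ (j + 1)) Q"
      unfolding bernstein_eigen_def by (metis coeff_P key coeff_smult)
  next
    assume ev: "bernstein_eigen m j (\<mu> * of_nat (n - 1) / of_nat n ^ (j + 1)) Q"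
    show "[:1, 1:] * S = smult \<mu> (Psi n S)"
    proof (rule poly_eqI)
      fix k
      \<comment> \<open>At \<open>k = 0\<close> the factor \<open>u\<close> vanishes and at
        \<open>k = n\<close> the factor \<open>v\<close>; beyond \<open>n\<close> the binomial
        coefficient is zero.\<close>
      consider "k = 0" | l where "k = Suc l" "l \<le> m" | l where "k = Suc l" "l > m"
        by (cases k) force+
      then show "coeff ([:1, 1:] * S) k = coeff (smult \<mu> (Psi n S)) k"
      proof cases
        case 1
        have "coeff (Psi n S) 0 = 0" unfolding coeff_Psi hom by simp
        with 1 show ?thesis by (simp add: S_def)
      next
        case 2
        then show ?thesis
          using ev key[of l] unfolding coeff_smult by (simp only: coeff_P bernstein_eigen_def)
      next
        case (3 l)
        have "degree ([:1, 1:] ^ (m - j) * Q) < l"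
          using degree_one_plus_power_mult[OF assms(3), of "m - j"] 3 by (simp add: m_def)
        then have "coeff ([:1, 1:] * S) k = 0"
          unfolding 3 coeff_P by (rule coeff_eq_0)
        moreover have "coeff (Psi n S) k = 0"
          unfolding coeff_Psi hom using 3 by (cases "k = n") (auto simp: binomial_eq_0 nm)
        ultimately show ?thesis by (simp only: coeff_smult mult_zero_right)
      qed
    qed
  qed
  then show ?thesis
    unfolding P using eigenspace_iff_Psi[OF assms(1) _ deg_S assms(4)]
    by (simp add: nm del: mult_pCons_left)
qed

text \<open>Replacing \<open>l\<close> by \<open>m - l\<close> exchanges the arguments
  \<open>l + 1\<close> and \<open>m + 1 - l\<close>, and reflection exchanges the variables of the
  homogenization.\<close>

lemma bernstein_eigen_reflect_poly:
  fixes Q :: "'a::idom poly"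
  assumes "bernstein_eigen m (degree Q) \<kappa> Q" "degree Q \<le> m" "Q \<noteq> 0"
  shows "bernstein_eigen m (degree Q) \<kappa> (reflect_poly Q)"
  unfolding bernstein_eigen_def
proof (intro allI impI)
  fix l assume l: "l \<le> m"
  let ?R = "[:1, 1:] ^ (m - degree Q) * Q"
  have "reflect_poly [:1, 1 :: 'a:] = [:1, 1:]"
    by (simp add: reflect_poly_def)
  then have R: "[:1, 1:] ^ (m - degree Q) * reflect_poly Q = reflect_poly ?R"
    by (simp add: reflect_poly_mult reflect_poly_power)
  have "degree ?R = m"
    using assms(2,3) by (simp add: degree_mult_eq degree_power_eq)
  then have "coeff ([:1, 1:] ^ (m - degree Q) * reflect_poly Q) l = coeff ?R (m - l)"
    unfolding R using l by (simp add: coeff_reflect_poly)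
  also have "\<dots> = \<kappa> * of_nat (m choose (m - l)) *
      hom_eval (degree Q) Q (of_nat (m - l + 1)) (of_nat (m + 1 - (m - l)))"
    using assms(1) unfolding bernstein_eigen_def by simp
  also have "m choose (m - l) = m choose l"
    using l by (rule binomial_symmetric[symmetric])
  also have "m - l + 1 = m + 1 - l" using l by simp
  also have "m + 1 - (m - l) = l + 1" using l by simp
  finally show "coeff ([:1, 1:] ^ (m - degree Q) * reflect_poly Q) l = \<kappa> * of_nat (m choose l) *
      hom_eval (degree Q) (reflect_poly Q) (of_nat (l + 1)) (of_nat (m + 1 - l))"
    by (simp only: hom_eval_reflect_poly)
qed

lemma poly_map_poly_of_real:
  "poly (map_poly of_real p) (of_real x :: 'a::{real_algebra_1,comm_ring_1}) = of_real (poly p x)"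
  by (induction p) (simp_all add: map_poly_pCons)

lemma coeff_one_plus_power_mult_of_real:
  "coeff ([:1, 1:] ^ k * map_poly of_real p :: 'a::{real_algebra_1,comm_ring_1} poly) l =
    of_real (coeff ([:1, 1:] ^ k * p) l)"
  by (simp add: coeff_mult coeff_map_poly coeff_one_plus_power)

lemma bernstein_eigen_of_real:
  "bernstein_eigen m j (of_real \<kappa> :: complex) (map_poly of_real Q) \<longleftrightarrow> bernstein_eigen m j \<kappa> Q"
proof -
  have "of_real \<kappa> * of_nat (m choose l) *
      hom_eval j (map_poly of_real Q) (of_nat (l + 1)) (of_nat (m + 1 - l)) =
      (of_real (\<kappa> * of_nat (m choose l) * hom_eval j Q (of_nat (l + 1)) (of_nat (m + 1 - l))) :: complex)" for l
    using hom_eval_of_real[of j Q "of_nat (l + 1)" "of_nat (m + 1 - l)", where ?'a = complex]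
    by simp
  then show ?thesis
    unfolding bernstein_eigen_def coeff_one_plus_power_mult_of_real by (simp only: of_real_eq_iff)
qed

text \<open>The number \<kappa> of \<open>bernstein_eigen\<close> belonging to
  \<open>eigenval n j\<close>; it equals \<open>1 / ((n - 2) ... (n - j - 1))\<close> when
  \<open>n > 1\<close>.\<close>

definition bernstein_val :: "nat \<Rightarrow> nat \<Rightarrow> real" where
  "bernstein_val n j = real (n - 1) / (\<Prod>i=1..j+1. real n - real i)"

lemma eigenval_eq:
  assumes "n \<ge> 1"
  shows "eigenval n j * of_nat (n - 1) / of_nat n ^ (j + 1) = of_real (bernstein_val n j)"
  using assms by (simp add: eigenval_def bernstein_val_def)

lemma bernstein_val_pos: "j + 3 \<le> n \<Longrightarrow> bernstein_val n j > 0"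
  unfolding bernstein_val_def by (intro divide_pos_pos prod_pos) auto

lemma bernstein_val_Suc: "bernstein_val n j = (real n - real (j + 2)) * bernstein_val n (Suc j)"
  if "j + 3 \<le> n"
proof -
  have "(\<Prod>i=1..Suc j+1. real n - real i) = (\<Prod>i=1..j+1. real n - real i) * (real n - real (j + 2))"
    by (simp add: algebra_simps)
  then show ?thesis
    using that unfolding bernstein_val_def by simp
qed

lemma eigenval_nonzero: "j + 3 \<le> n \<Longrightarrow> eigenval n j \<noteq> 0"
  using bernstein_val_pos[of j n] eigenval_eq[of n j] by fastforce

text \<open>The reflected polynomial satisfies the same eigenvalue equation, and the eigenspace is a
  line, so it is a multiple of \<open>Q\<close>.\<close>

lemma is_Q_imp:
  assumes "is_Phi n \<Phi>" "is_Q n \<Phi> j Q" "j + 3 \<le> n" "poly Q (-1) \<noteq> 0"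
  shows "bernstein_eigen (n - 2) j (bernstein_val n j) Q"
    and "reflect_poly Q = smult ((-1) ^ j) Q"
proof -
  define Qc :: "complex poly" where "Qc = map_poly of_real Q"
  define V where "V R = [:0, 1:] * [:1, 1:] ^ (n - 2 - j) * R" for R :: "complex poly"
  have Q: "degree Q = j" "lead_coeff Q = 1"
    and eig: "eigenspace n \<Phi> (eigenval n j) = range (\<lambda>c. smult c (V Qc))"
    using assms(2) unfolding is_Q_def V_def Qc_def by auto
  have deg: "degree Qc = j" unfolding Qc_def by (simp add: degree_map_poly Q)
  have "Q \<noteq> 0" using Q by auto
  then have "Qc \<noteq> 0" by (auto simp: Qc_def map_poly_eq_0_iff)
  have "smult 1 (V Qc) \<in> eigenspace n \<Phi> (eigenval n j)"
    unfolding eig by (rule rangeI)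
  then have ev: "bernstein_eigen (n - 2) j (of_real (bernstein_val n j)) Qc"
    using eigenspace_iff_bernstein_eigen[OF assms(1,3) _ eigenval_nonzero[OF assms(3)], of Qc] deg
      eigenval_eq[of n j] assms(3) by (simp add: V_def del: mult_pCons_left)
  then show "bernstein_eigen (n - 2) j (bernstein_val n j) Q"
    unfolding Qc_def by (simp only: bernstein_eigen_of_real)
  have "bernstein_eigen (n - 2) j (of_real (bernstein_val n j)) (reflect_poly Qc)"
    using bernstein_eigen_reflect_poly[of "n - 2" Qc] ev \<open>Qc \<noteq> 0\<close> deg assms(3) by simp
  then have "V (reflect_poly Qc) \<in> eigenspace n \<Phi> (eigenval n j)"
    using eigenspace_iff_bernstein_eigen[OF assms(1,3) _ eigenval_nonzero[OF assms(3)], of "reflect_poly Qc"] deg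
      eigenval_eq[of n j] assms(3) degree_reflect_poly_le[of Qc] by (simp add: V_def del: mult_pCons_left)
  then obtain c where "V (reflect_poly Qc) = smult c (V Qc)"
    unfolding eig by blast
  then have "[:0, 1:] * [:1, 1:] ^ (n - 2 - j) * reflect_poly Qc =
      [:0, 1:] * [:1, 1:] ^ (n - 2 - j) * smult c Qc"
    unfolding V_def by (simp only: mult_smult_right)
  then have c: "reflect_poly Qc = smult c Qc"
    by (subst (asm) mult_cancel_left) simp
  \<comment> \<open>As -1 is its own reciprocal, evaluation there determines the factor
    \<open>c\<close>.\<close>
  have "poly Qc (-1) = of_real (poly Q (-1))"
    using poly_map_poly_of_real[of Q "-1", where ?'a = complex] by (simp add: Qc_def)
  then have "poly Qc (-1) \<noteq> 0" using assms(4) by simp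
  moreover have "(-1) ^ j * poly Qc (-1) = c * poly Qc (-1)"
    using arg_cong[OF c, of "\<lambda>p. poly p (-1)"] by (simp add: poly_reflect_poly_nz deg)
  ultimately have c': "c = (-1) ^ j" by simp
  show "reflect_poly Q = smult ((-1) ^ j) Q"
  proof (rule poly_eqI)
    fix k
    have "of_real (coeff (reflect_poly Q) k) = coeff (reflect_poly Qc) k"
      by (simp add: Qc_def coeff_reflect_poly degree_map_poly coeff_map_poly)
    also have "\<dots> = of_real (coeff (smult ((-1) ^ j) Q) k)"
      unfolding c c' by (simp add: Qc_def coeff_map_poly)
    finally show "coeff (reflect_poly Q) k = coeff (smult ((-1) ^ j) Q) k"
      by (simp only: of_real_eq_iff)
  qed
qed

section \<open>Sign changes in the pencil spanned by \<open>(1 + x)^2 P\<close> and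
  \<open>R\<close>\<close>

lemma alternates_mult_pos:
  assumes "alternates X f k" "\<And>x. x \<in> X \<Longrightarrow> 0 < g x"
  shows "alternates X (\<lambda>x. g x * f x) k"
proof -
  obtain t s where t: "\<And>i j. i < j \<Longrightarrow> j \<le> k \<Longrightarrow> t i < t j" "\<And>i. i \<le> k \<Longrightarrow> t i \<in> X"
    "\<And>i. i \<le> k \<Longrightarrow> 0 < s * (-1) ^ i * f (t i)"
    using assms(1) by (rule alternatesE) blast
  show ?thesis
  proof (rule alternatesI)
    show "0 < s * (-1) ^ i * (g (t i) * f (t i))" if "i \<le> k" for i
      using mult_pos_pos[OF assms(2)[OF t(2)] t(3), OF that that] by (simp add: mult_ac)
  qed (use t in auto)
qed

text \<open>The two eigenvalue equations combine: coefficients of the pencil member with parameter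
  \<open>\<delta> * \<rho>\<close>, times a power of \<open>1 + x\<close>, are positive multiples of
  sampled values of the member with parameter \<delta>. So \<open>hom_eval_alternates\<close>
  applies.\<close>

lemma bernstein_eigen_pencil_step:
  fixes P R :: "real poly"
  assumes P: "bernstein_eigen m j \<kappa> P" "degree P \<le> j"
    and R: "bernstein_eigen m (j + 2) \<kappa>' R" "degree R \<le> j + 2"
    and "j + 2 \<le> m" "\<kappa> > 0" and \<rho>: "\<kappa> = \<rho> * real (m + 2) ^ 2 * \<kappa>'"
    and alt: "alternates {0<..} (poly ([:1, 1:] ^ 2 * P + smult (\<delta> * \<rho>) R)) k"
  shows "alternates {0<..} (poly ([:1, 1:] ^ 2 * P + smult \<delta> R)) k"
proof (rule hom_eval_alternates)
  let ?F = "[:1, 1:] ^ 2 * P + smult (\<delta> * \<rho>) R"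
  let ?d = "m - (j + 2)"
  have deg: "degree ([:1, 1:] ^ 2 * P + smult c R) \<le> j + 2" for c
    using degree_one_plus_power_mult[OF P(2), of 2] R(2)
    by (intro degree_add_le) (auto intro: order.trans[OF degree_smult_le] simp: add.commute)
  show "degree ([:1, 1:] ^ 2 * P + smult \<delta> R) \<le> j + 2" by (rule deg)
  show "degree ([:1, 1:] ^ ?d * ?F) \<le> m"
  proof -
    have "degree ([:1, 1:] ^ ?d * ?F) \<le> ?d + (j + 2)"
      by (rule degree_one_plus_power_mult[OF deg])
    also have "?d + (j + 2) = m" using assms(5) by (rule le_add_diff_inverse2)
    finally show ?thesis .
  qed
  show "0 \<le> \<kappa> / real (m + 2) ^ 2 * real (m choose l)" for l
    using \<open>\<kappa> > 0\<close> by simp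
  show "coeff ([:1, 1:] ^ ?d * ?F) l = \<kappa> / real (m + 2) ^ 2 * real (m choose l) *
      hom_eval (j + 2) ([:1, 1:] ^ 2 * P + smult \<delta> R) (real (l + 1)) (real (m + 1 - l))"
    if "l \<le> m" for l
  proof -
    let ?u = "real (l + 1)" and ?v = "real (m + 1 - l)"
    \<comment> \<open>The factor \<open>(1 + x)^2\<close> homogenizes to \<open>(u + v)^2\<close>,
      which is \<open>(m + 2)^2\<close> at every sample point; this is the square in the relation
      between \<kappa> and \<open>\<kappa>'\<close>.\<close>
    have uv: "?v + ?u = real (m + 2)" using that by simp
    have "hom_eval (j + 2) ([:1, 1:] ^ 2 * P) ?u ?v = real (m + 2) ^ 2 * hom_eval j P ?u ?v"
      using hom_eval_linear_power_mult[OF P(2), of 2 1 1 ?u ?v] uv by (simp add: add.commute)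
    then have hom: "hom_eval (j + 2) ([:1, 1:] ^ 2 * P + smult \<delta> R) ?u ?v =
        real (m + 2) ^ 2 * hom_eval j P ?u ?v + \<delta> * hom_eval (j + 2) R ?u ?v"
      by (simp only: hom_eval_add hom_eval_smult)
    have "m - j = ?d + 2" using assms(5) by simp
    then have "[:1, 1:] ^ ?d * ?F = [:1, 1:] ^ (m - j) * P + smult (\<delta> * \<rho>) ([:1, 1:] ^ ?d * R)"
      by (simp only: distrib_left power_add mult.assoc mult_smult_right)
    then have "coeff ([:1, 1:] ^ ?d * ?F) l =
        \<kappa> * real (m choose l) * hom_eval j P ?u ?v +
        (\<delta> * \<rho>) * (\<kappa>' * real (m choose l) * hom_eval (j + 2) R ?u ?v)"
      using P(1) R(1) that unfolding bernstein_eigen_def by (simp only: coeff_add coeff_smult)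
    also have "\<dots> = \<kappa> / real (m + 2) ^ 2 * real (m choose l) *
        (real (m + 2) ^ 2 * hom_eval j P ?u ?v + \<delta> * hom_eval (j + 2) R ?u ?v)"
    proof -
      have q: "\<kappa> / real (m + 2) ^ 2 = \<rho> * \<kappa>'" unfolding \<rho> by simp
      show ?thesis unfolding q by (simp only: \<rho> algebra_simps)
    qed
    finally show ?thesis unfolding hom .
  qed
  have "poly ([:1, 1:] ^ ?d * ?F) = (\<lambda>x. (1 + x) ^ ?d * poly ?F x)"
    by (simp add: fun_eq_iff)
  then show "alternates {0<..} (poly ([:1, 1:] ^ ?d * ?F)) k"
    using alternates_mult_pos[OF alt, of "\<lambda>x. (1 + x) ^ ?d"] by simp
qed

text \<open>Repeating the previous step drives the coefficient of \<open>R\<close> to \<open>0\<close>.\<close>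

lemma bernstein_eigen_pencil_alternates:
  fixes P R :: "real poly"
  assumes P: "bernstein_eigen m j \<kappa> P" "degree P \<le> j"
    and R: "bernstein_eigen m (j + 2) \<kappa>' R" "degree R \<le> j + 2"
    and m: "j + 2 \<le> m" and \<kappa>: "\<kappa> > 0" "\<kappa> = \<rho> * real (m + 2) ^ 2 * \<kappa>'"
    and \<rho>: "0 \<le> \<rho>" "\<rho> < 1"
    and alt: "alternates {0<..} (poly P) k"
  shows "alternates {0<..} (poly ([:1, 1:] ^ 2 * P + smult \<delta> R)) k"
proof -
  \<comment> \<open>For large \<open>N\<close> the term with \<open>\<delta> * \<rho> ^ N\<close> is
    too small to change signs at the finitely many points \<open>t i\<close>. From there
    \<open>N\<close> applications of the previous lemma lead to \<open>?F 0\<close>.\<close>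
  let ?F = "\<lambda>N. [:1, 1:] ^ 2 * P + smult (\<delta> * \<rho> ^ N) R"
  obtain t s where t: "\<And>i j. i < j \<Longrightarrow> j \<le> k \<Longrightarrow> t i < t j" "\<And>i. i \<le> k \<Longrightarrow> t i \<in> {0<..}"
    and st: "\<And>i. i \<le> k \<Longrightarrow> 0 < s * (-1) ^ i * ((1 + t i) ^ 2 * poly P (t i))"
    using alternates_mult_pos[OF alt, of "\<lambda>x. (1 + x) ^ 2"] by (rule alternatesE) auto
  have "\<forall>\<^sub>F N in sequentially. \<forall>i\<in>{..k}. 0 < s * (-1) ^ i * poly (?F N) (t i)"
  proof (intro eventually_ball_finite ballI finite_atMost)
    fix i assume "i \<in> {..k}"
    have "(\<lambda>N. s * (-1) ^ i * ((1 + t i) ^ 2 * poly P (t i) + \<delta> * \<rho> ^ N * poly R (t i)))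
        \<longlonglongrightarrow> s * (-1) ^ i * ((1 + t i) ^ 2 * poly P (t i) + \<delta> * 0 * poly R (t i))"
      by (intro tendsto_intros LIMSEQ_realpow_zero \<rho>)
    moreover have "poly (?F N) (t i) = (1 + t i) ^ 2 * poly P (t i) + \<delta> * \<rho> ^ N * poly R (t i)" for N
      by (simp add: algebra_simps)
    ultimately show "\<forall>\<^sub>F N in sequentially. 0 < s * (-1) ^ i * poly (?F N) (t i)"
      using st[of i] \<open>i \<in> {..k}\<close> by (simp only: order_tendstoD(1)) (rule order_tendstoD(1), auto)
  qed
  then obtain N where N: "\<forall>i\<in>{..k}. 0 < s * (-1) ^ i * poly (?F N) (t i)"
    using eventually_happens'[OF sequentially_bot] by blast
  have "alternates {0<..} (poly (?F N)) k"
    by (rule alternatesI[where t = t and s = s]) (use t N in auto)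
  then have "alternates {0<..} (poly (?F 0)) k"
  proof (induction N)
    case (Suc N)
    have "alternates {0<..} (poly ([:1, 1:] ^ 2 * P + smult (\<delta> * \<rho> ^ N * \<rho>) R)) k"
      using Suc.prems by (simp only: power_Suc2 mult.assoc)
    then show ?case
      by (rule Suc.IH[OF bernstein_eigen_pencil_step[OF P R m \<kappa>]])
  qed
  then show ?thesis by simp
qed

lemma double_root_dvd:
  fixes f :: "'a::{comm_ring_1,ring_no_zero_divisors} poly"
  assumes "poly f a = 0" "poly (pderiv f) a = 0"
  obtains g where "f = [:- a, 1:] ^ 2 * g"
proof -
  obtain h where h: "f = [:- a, 1:] * h"
    using assms(1) poly_eq_0_iff_dvd[of f a] by (auto elim: dvdE)
  have "poly h a = 0"
    using assms(2) unfolding h pderiv_mult by (simp add: pderiv_pCons)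
  then obtain g where g: "h = [:- a, 1:] * g"
    using poly_eq_0_iff_dvd[of h a] by (auto elim: dvdE)
  show thesis
    by (rule that[of g]) (simp only: h g power2_eq_square mult.assoc)
qed

text \<open>The symmetry produces a second double root \<open>1 / y\<close>, different from
  \<open>y\<close>. Removing two squares keeps \<open>j\<close> sign changes but lowers the degree
  by 4.\<close>

lemma no_double_root_of_reciprocal:
  fixes f :: "real poly"
  assumes "degree f \<le> j + 2" "alternates {0<..} (poly f) j"
    and sym: "\<And>t. t > 0 \<Longrightarrow> t ^ (j + 2) * poly f (1 / t) = \<epsilon> * poly f t" and "\<epsilon> \<noteq> 0"
    and y: "y > 0" "y \<noteq> 1" "poly f y = 0" "poly (pderiv f) y = 0"
  shows False
proof -
  define b where "b = 1 / y"
  have b: "b > 0" "1 / b = y"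
    using y by (simp_all add: b_def)
  have "b \<noteq> y"
  proof
    assume "b = y"
    then have "y * y = 1" using y(1) by (simp add: b_def field_simps)
    then show False using y(1,2) by (simp add: square_eq_1_iff)
  qed
  have fb: "poly f b = 0"
    using sym[of b] b y \<open>\<epsilon> \<noteq> 0\<close> by simp
  \<comment> \<open>Both \<open>f\<close> and its derivative vanish at \<open>1 / b = y\<close>, so
    the left side of the symmetry relation has derivative 0 at \<open>b\<close>, hence so has the
    right side.\<close>
  have "((\<lambda>t. poly f (1 / t)) has_real_derivative poly (pderiv f) (1 / b) * (- 1 / b ^ 2)) (at b)"
    using b(1) by (auto intro!: derivative_eq_intros DERIV_chain2[OF poly_DERIV] simp: power2_eq_square)
  from DERIV_mult[OF DERIV_pow this]
  have "((\<lambda>t. t ^ n * poly f (1 / t)) has_real_derivative 0) (at b)" for n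
    unfolding b(2) y(3,4) by simp
  from this[of "j + 2"] have "((\<lambda>t. \<epsilon> * poly f t) has_real_derivative 0) (at b)"
    by (rule has_field_derivative_transform_within_open[where S = "{0<..}"]) (use sym b(1) in auto)
  moreover have "((\<lambda>t. \<epsilon> * poly f t) has_real_derivative \<epsilon> * poly (pderiv f) b) (at b)"
    by (intro DERIV_cmult poly_DERIV)
  ultimately have f'b: "poly (pderiv f) b = 0"
    using DERIV_unique \<open>\<epsilon> \<noteq> 0\<close> by fastforce
  obtain g where g: "f = [:- y, 1:] ^ 2 * g"
    using double_root_dvd[OF y(3,4)] .
  have gb: "poly g b = 0"
    using fb \<open>b \<noteq> y\<close> unfolding g by simp
  have "poly (pderiv g) b = 0"
    using f'b gb \<open>b \<noteq> y\<close> unfolding g pderiv_mult by simp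
  then obtain h where h: "g = [:- b, 1:] ^ 2 * h"
    using double_root_dvd[OF gb] by blast
  have f: "f = [:- y, 1:] ^ 2 * ([:- b, 1:] ^ 2 * h)"
    unfolding g h ..
  obtain t s where t: "\<And>i k. i < k \<Longrightarrow> k \<le> j \<Longrightarrow> t i < t k" "\<And>i. i \<le> j \<Longrightarrow> t i \<in> {0<..}"
    and st: "\<And>i. i \<le> j \<Longrightarrow> 0 < s * (-1) ^ i * poly f (t i)"
    using assms(2) by (rule alternatesE) blast
  have "alternates {0<..} (poly h) j"
  proof (rule alternatesI)
    show "0 < s * (-1) ^ i * poly h (t i)" if "i \<le> j" for i
    proof -
      have "poly f (t i) = ((t i - y) ^ 2 * (t i - b) ^ 2) * poly h (t i)"
        unfolding f by (simp add: algebra_simps)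
      then have "0 < ((t i - y) ^ 2 * (t i - b) ^ 2) * (s * (-1) ^ i * poly h (t i))"
        using st[OF that] by (simp only: mult_ac)
      moreover have "0 \<le> (t i - y) ^ 2 * (t i - b) ^ 2" by simp
      ultimately show ?thesis by (metis mult_le_0_iff not_le)
    qed
  qed (use t in auto)
  from alternates_le_degree[OF this] have "j \<le> degree h" "h \<noteq> 0" .
  moreover have "degree f = 4 + degree h"
    unfolding f using \<open>h \<noteq> 0\<close> by (simp add: degree_mult_eq degree_power_eq del: mult_pCons_left)
  ultimately show False using assms(1) by simp
qed

subsection \<open>Interlacing\<close>

text \<open>Otherwise Rolle's theorem applies to \<open>B / A\<close>, whose derivative has the
  Wronskian as numerator. At the end points \<open>B\<close> vanishes, so the nonzero Wronskian
  forces \<open>A\<close> to be nonzero there.\<close>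

lemma root_between_roots:
  fixes A B :: "real poly"
  assumes "a < b" "poly B a = 0" "poly B b = 0"
    and W: "\<And>t. a \<le> t \<Longrightarrow> t \<le> b \<Longrightarrow>
      poly A t * poly (pderiv B) t - poly (pderiv A) t * poly B t \<noteq> 0"
  shows "\<exists>t. a < t \<and> t < b \<and> poly A t = 0"
proof (rule ccontr)
  assume no: "\<not> ?thesis"
  have A: "poly A t \<noteq> 0" if "a \<le> t" "t \<le> b" for t
    using no W[of a] W[of b] assms that by (cases "t = a \<or> t = b") auto
  have "\<exists>z. a < z \<and> z < b \<and> poly B b / poly A b - poly B a / poly A a =
      (b - a) * ((poly (pderiv B) z * poly A z - poly B z * poly (pderiv A) z) / (poly A z * poly A z))"
    by (rule MVT2[OF \<open>a < b\<close>]) (intro DERIV_divide poly_DERIV A)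
  then obtain z where "a < z" "z < b"
    "(b - a) * ((poly (pderiv B) z * poly A z - poly B z * poly (pderiv A) z) / (poly A z * poly A z)) = 0"
    using assms by auto
  then have "poly (pderiv B) z * poly A z - poly B z * poly (pderiv A) z = 0"
    using A[of z] \<open>a < b\<close> by simp
  then show False
    using W[of z] \<open>a < z\<close> \<open>z < b\<close> by (simp add: mult.commute)
qed

text \<open>Counting from the left gives \<open>i \<le> s i\<close>, counting from the right
  \<open>s i \<le> i\<close>. This turns "some root" into "the \<open>i\<close>-th root"
  below.\<close>

lemma strict_mono_on_self_map:
  fixes s :: "nat \<Rightarrow> nat"
  assumes mono: "\<And>i k. 1 \<le> i \<Longrightarrow> i < k \<Longrightarrow> k \<le> d \<Longrightarrow> s i < s k"
    and range: "\<And>i. 1 \<le> i \<Longrightarrow> i \<le> d \<Longrightarrow> 1 \<le> s i \<and> s i \<le> d"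
    and i: "1 \<le> i" "i \<le> d"
  shows "s i = i"
proof (rule antisym)
  show "i \<le> s i"
    using i
  proof (induction i)
    case (Suc i)
    then show ?case using mono[of i "Suc i"] range[of "Suc i"] by (cases "i = 0") auto
  qed simp
  have "s i + k \<le> s (i + k)" if "i + k \<le> d" for k
    using that
  proof (induction k)
    case (Suc k)
    then show ?case using mono[of "i + k" "Suc (i + k)"] i by simp
  qed simp
  from this[of "d - i"] have "s i + (d - i) \<le> s d" using i by simp
  also have "s d \<le> d" using range[of d] i by simp
  finally show "s i \<le> i" using i by linarith
qed

section \<open>Increasing enumerations of positive roots and their reciprocal symmetry\<close>

context
  fixes Q :: "real poly" and m :: nat and x :: "nat \<Rightarrow> real"
  assumes enum: "positive_roots_enum Q m x"
begin

lemma enum_mono: "1 \<le> i \<Longrightarrow> i < k \<Longrightarrow> k \<le> m \<Longrightarrow> x i < x k"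
  using enum by (auto simp: positive_roots_enum_def strict_mono_on_def)

lemma enum_mono_iff: "i \<in> {1..m} \<Longrightarrow> k \<in> {1..m} \<Longrightarrow> x i < x k \<longleftrightarrow> i < k"
  using enum_mono[of i k] enum_mono[of k i] by (cases i k rule: linorder_cases) auto

lemma enum_pos: "1 \<le> i \<Longrightarrow> i \<le> m \<Longrightarrow> 0 < x i"
  using enum by (auto simp: positive_roots_enum_def)

lemma enum_root: "1 \<le> i \<Longrightarrow> i \<le> m \<Longrightarrow> poly Q (x i) = 0"
  using enum by (auto simp: positive_roots_enum_def)

lemma enum_obtain: "poly Q t = 0 \<Longrightarrow> \<exists>i\<in>{1..m}. t = x i"
  using enum by (auto simp: positive_roots_enum_def)

lemma enum_card: "card {t. poly Q t = 0} = m"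
proof -
  have "inj_on x {1..m}"
    using enum by (auto simp: positive_roots_enum_def intro: strict_mono_on_imp_inj_on)
  then have "card (x ` {1..m}) = m" by (simp add: card_image)
  then show ?thesis using enum by (simp add: positive_roots_enum_def)
qed

lemma enum_nonzero_at_neg: "t \<le> 0 \<Longrightarrow> poly Q t \<noteq> 0"
  using enum_obtain[of t] enum_pos by fastforce

text \<open>Dropping one factor of a double root would leave a polynomial of degree below
  \<open>m\<close> that still has all \<open>m\<close> roots.\<close>

lemma enum_simple_root:
  assumes "degree Q = m" "Q \<noteq> 0" "poly Q t = 0"
  shows "poly (pderiv Q) t \<noteq> 0"
proof
  assume "poly (pderiv Q) t = 0"
  then obtain g where g: "Q = [:- t, 1:] ^ 2 * g"
    using double_root_dvd[OF assms(3)] by blast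
  let ?R = "[:- t, 1:] * g"
  have "?R \<noteq> 0" using assms(2) g by (auto simp del: mult_pCons_left)
  have "card {t. poly Q t = 0} \<le> card {t. poly ?R t = 0}"
    by (intro card_mono poly_roots_finite \<open>?R \<noteq> 0\<close>) (auto simp: g)
  also have "\<dots> \<le> degree ?R"
    by (rule card_poly_roots_bound[OF \<open>?R \<noteq> 0\<close>])
  also have "\<dots> < degree Q"
    unfolding g using \<open>?R \<noteq> 0\<close> by (auto simp: degree_mult_eq degree_power_eq simp del: mult_pCons_left)
  finally show False using enum_card assms(1) by simp
qed

lemma enum_prod:
  assumes "degree Q = m" "lead_coeff Q = 1"
  shows "Q = (\<Prod>i=1..m. [:- x i, 1:])"
proof (rule poly_eqI_degree_lead_coeff[where n = m and A = "{t. poly Q t = 0}"])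
  have deg: "degree (\<Prod>i=1..m. [:- x i, 1:]) = m"
    by (subst degree_prod_sum_eq) auto
  then show "degree (\<Prod>i=1..m. [:- x i, 1:]) \<le> m" by simp
  have "coeff (\<Prod>i=1..m. [:- x i, 1:]) m = lead_coeff (\<Prod>i=1..m. [:- x i, 1:])"
    by (simp only: deg)
  also have "\<dots> = 1" by (simp only: lead_coeff_prod) simp
  finally show "coeff Q m = coeff (\<Prod>i=1..m. [:- x i, 1:]) m"
    using assms by simp
  show "poly Q z = poly (\<Prod>i=1..m. [:- x i, 1:]) z" if "z \<in> {t. poly Q t = 0}" for z
    using enum_obtain[of z] that by (auto simp: poly_prod)
qed (use enum_card assms in auto)

lemma enum_alternates:
  assumes "degree Q = m" "lead_coeff Q = 1" "m \<ge> 1"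
  shows "alternates {0<..} (poly Q) m"
proof -
  \<comment> \<open>One point in each gap between consecutive roots, one between 0 and the first
    root, one beyond the last.\<close>
  define t where "t i = (if i = 0 then x 1 / 2 else if i < m then (x i + x (i + 1)) / 2 else x m + 1)" for i
  have above: "x k < t i" if "1 \<le> k" "k \<le> i" "i \<le> m" for i k
  proof -
    have "x k \<le> x i" using enum_mono[of k i] that by (cases "k = i") auto
    also have "x i < t i" using enum_mono[of i "i + 1"] that by (auto simp: t_def)
    finally show ?thesis .
  qed
  have below: "t i < x k" if "i < k" "k \<le> m" for i k
  proof -
    have "t i < x (Suc i)"
      using enum_mono[of i "i + 1"] enum_pos[of 1] that by (auto simp: t_def)
    also have "x (Suc i) \<le> x k" using enum_mono[of "Suc i" k] that by (cases "k = Suc i") auto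
    finally show ?thesis .
  qed
  show ?thesis
  proof (rule alternatesI)
    show "t i < t (Suc i)" if "i < m" for i
      using below[of i "Suc i"] above[of "Suc i" "Suc i"] that by simp
    show "t i \<in> {0<..}" if "i \<le> m" for i
      using above[of i i] enum_pos[of i] enum_pos[of 1] assms(3) that by (cases "i = 0") (auto simp: t_def)
    show "0 < (-1) ^ m * (-1) ^ i * poly Q (t i)" if "i \<le> m" for i
    proof -
      \<comment> \<open>At \<open>t i\<close> exactly the \<open>m - i\<close> factors with
        \<open>k > i\<close> are negative.\<close>
      have "0 < (\<Prod>k=1..m. (if k \<le> i then 1 else -1) * (t i - x k))"
        using above below that by (intro prod_pos) auto
      also have "\<dots> = (\<Prod>k=1..m. if k \<le> i then 1 else -1) * (\<Prod>k=1..m. t i - x k)"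
        by (rule prod.distrib)
      also have "(\<Prod>k=1..m. if k \<le> i then 1 else -1) = (-1 :: real) ^ (m - i)"
      proof -
        have "{1..m} \<inter> - {k. k \<le> i} = {i<..m}" by auto
        then show ?thesis by (simp add: prod.If_cases)
      qed
      also have "\<dots> = (-1) ^ m * (-1) ^ i"
        using that by (auto simp: minus_one_power_iff)
      also have "(\<Prod>k=1..m. t i - x k) = poly Q (t i)"
        by (subst enum_prod[OF assms(1,2)]) (simp add: poly_prod)
      finally show ?thesis .
    qed
  qed
qed

text \<open>Reciprocals permute the roots and reverse their order, so the index of
  \<open>1 / x (m + 1 - i)\<close> is a strictly increasing function of \<open>i\<close>, hence
  \<open>i\<close> itself.\<close>

lemma enum_inverse:
  assumes inv: "\<And>t. t > 0 \<Longrightarrow> poly Q t = 0 \<Longrightarrow> poly Q (1 / t) = 0" and i: "1 \<le> i" "i \<le> m"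
  shows "x i * x (m + 1 - i) = 1"
proof -
  have "\<exists>k\<in>{1..m}. 1 / x (m + 1 - i) = x k" if "1 \<le> i" "i \<le> m" for i
    using enum_obtain inv[of "x (m + 1 - i)"] enum_pos[of "m + 1 - i"] enum_root[of "m + 1 - i"] that by simp
  then obtain s where s: "\<And>i. 1 \<le> i \<Longrightarrow> i \<le> m \<Longrightarrow> s i \<in> {1..m}"
    "\<And>i. 1 \<le> i \<Longrightarrow> i \<le> m \<Longrightarrow> 1 / x (m + 1 - i) = x (s i)"
    by metis
  have "s i = i"
  proof (rule strict_mono_on_self_map[where d = m])
    fix i k assume ik: "1 \<le> i" "i < k" "k \<le> m"
    have "0 < x (m + 1 - k)" "x (m + 1 - k) < x (m + 1 - i)"
      using ik by (auto intro!: enum_pos enum_mono)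
    then have "1 / x (m + 1 - i) < 1 / x (m + 1 - k)"
      by (intro divide_strict_left_mono) auto
    then have "x (s i) < x (s k)" using s(2) ik by simp
    then show "s i < s k" using enum_mono_iff s(1) ik by simp
  qed (use s i in auto)
  then have "x i = 1 / x (m + 1 - i)"
    using s(2)[OF i] by simp
  moreover have "0 < x (m + 1 - i)" using i by (intro enum_pos) auto
  ultimately show ?thesis by (simp add: field_simps)
qed

lemma enum_less_one_iff:
  assumes inv: "\<And>t. t > 0 \<Longrightarrow> poly Q t = 0 \<Longrightarrow> poly Q (1 / t) = 0" and i: "1 \<le> i" "i \<le> m"
  shows "x i < 1 \<longleftrightarrow> i \<le> m div 2"
proof
  assume "i \<le> m div 2"
  then have "x i < x (m + 1 - i)" using i by (intro enum_mono) auto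
  show "x i < 1"
  proof (rule ccontr)
    assume "\<not> x i < 1"
    then have "1 * 1 < x i * x (m + 1 - i)"
      using \<open>x i < x (m + 1 - i)\<close> by (intro mult_le_less_imp_less) auto
    then show False using enum_inverse[OF assms] by simp
  qed
next
  assume "x i < 1"
  show "i \<le> m div 2"
  proof (rule ccontr)
    assume "\<not> ?thesis"
    then have "1 \<le> m + 1 - i" "m + 1 - i \<le> i" using i by linarith+
    then have "x (m + 1 - i) \<le> x i"
      using enum_mono[of "m + 1 - i" i] i(2) by (cases "m + 1 - i = i") force+
    moreover have p: "0 < x (m + 1 - i)" using i by (intro enum_pos) auto
    ultimately have "x i * x (m + 1 - i) < 1 * 1"
      using \<open>x i < 1\<close> p by (intro mult_strict_mono) auto
    then show False using enum_inverse[OF assms] by simp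
  qed
qed

lemma enum_middle:
  assumes inv: "\<And>t. t > 0 \<Longrightarrow> poly Q t = 0 \<Longrightarrow> poly Q (1 / t) = 0" and "odd m"
  shows "x ((m + 1) div 2) = 1"
proof -
  obtain k where k: "m = 2 * k + 1" using \<open>odd m\<close> by (rule oddE)
  have "x (k + 1) * x (k + 1) = 1"
    using enum_inverse[OF inv, of "k + 1"] k by simp
  then have "x (k + 1) = 1"
    using enum_pos[of "k + 1"] k square_eq_1_iff[of "x (k + 1)"] by auto
  then show ?thesis using k by simp
qed

end

lemma reflect_poly_inverse:
  fixes Q :: "real poly"
  assumes "reflect_poly Q = smult c Q" "t \<noteq> 0"
  shows "t ^ degree Q * poly Q (1 / t) = c * poly Q t"
  using poly_reflect_poly_nz[OF assms(2), of Q] assms(1) by (simp add: inverse_eq_divide)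

text \<open>A zero of the Wronskian gives a pencil member with a double zero at \<open>t\<close>.
  That member has \<open>j\<close> sign changes and is reciprocal, since \<open>(1 + x)^2 P\<close>
  and \<open>R\<close> have the same sign under reflection in degree \<open>j + 2\<close>.\<close>

lemma bernstein_eigen_wronskian_nonzero:
  fixes P R :: "real poly"
  assumes P: "bernstein_eigen m j \<kappa> P" "degree P = j" "reflect_poly P = smult ((-1) ^ j) P"
    and R: "bernstein_eigen m (j + 2) \<kappa>' R" "degree R = j + 2" "reflect_poly R = smult ((-1) ^ j) R"
    and m: "j + 2 \<le> m" and \<kappa>: "\<kappa> > 0" "\<kappa> = \<rho> * real (m + 2) ^ 2 * \<kappa>'"
    and \<rho>: "0 \<le> \<rho>" "\<rho> < 1"
    and alt: "alternates {0<..} (poly P) j"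
    and simple: "\<And>t. poly R t = 0 \<Longrightarrow> poly (pderiv R) t \<noteq> 0"
    and t: "0 < t" "t \<noteq> 1"
  defines "A \<equiv> [:1, 1:] ^ 2 * P"
  shows "poly A t * poly (pderiv R) t - poly (pderiv A) t * poly R t \<noteq> 0"
proof
  assume W: "poly A t * poly (pderiv R) t - poly (pderiv A) t * poly R t = 0"
  \<comment> \<open>The two equations for \<delta> are dependent; simplicity of the roots of
    \<open>R\<close> ensures that \<open>R\<close> and its derivative do not both vanish at
    \<open>t\<close>, so one of them can be solved.\<close>
  have "\<exists>\<delta>. poly A t + \<delta> * poly R t = 0 \<and> poly (pderiv A) t + \<delta> * poly (pderiv R) t = 0"
  proof (cases "poly R t = 0")
    case True
    with simple have "poly (pderiv R) t \<noteq> 0" by blast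
    with W True show ?thesis
      by (intro exI[of _ "- poly (pderiv A) t / poly (pderiv R) t"]) simp
  next
    case False
    with W show ?thesis
      by (intro exI[of _ "- poly A t / poly R t"]) (simp add: field_simps)
  qed
  then obtain \<delta> where \<delta>: "poly A t + \<delta> * poly R t = 0" "poly (pderiv A) t + \<delta> * poly (pderiv R) t = 0"
    by blast
  show False
  proof (rule no_double_root_of_reciprocal[OF _ _ _ _ t])
    show "degree (A + smult \<delta> R) \<le> j + 2"
      unfolding A_def using degree_one_plus_power_mult[of P j 2] P(2) R(2)
      by (intro degree_add_le) (auto intro: order.trans[OF degree_smult_le] simp: add.commute)
    show "alternates {0<..} (poly (A + smult \<delta> R)) j"
      unfolding A_def using P(2) R(2)
      by (intro bernstein_eigen_pencil_alternates[OF P(1) _ R(1) _ m \<kappa> \<rho> alt]) simp_all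
    show "poly (A + smult \<delta> R) t = 0" "poly (pderiv (A + smult \<delta> R)) t = 0"
      using \<delta> by (simp_all add: pderiv_add pderiv_smult)
    show "(-1 :: real) ^ j \<noteq> 0" by simp
    show "u ^ (j + 2) * poly (A + smult \<delta> R) (1 / u) = (-1) ^ j * poly (A + smult \<delta> R) u"
      if "u > 0" for u :: real
    proof -
      have "u * (1 + 1 / u) = 1 + u" using that by (simp add: field_simps)
      then have "u ^ 2 * (1 + 1 / u) ^ 2 = (1 + u) ^ 2" by (simp flip: power_mult_distrib)
      moreover have "u ^ (j + 2) * poly A (1 / u) = u ^ 2 * (1 + 1 / u) ^ 2 * (u ^ j * poly P (1 / u))"
        by (simp only: A_def power_add poly_mult poly_power) simp
      ultimately have "u ^ (j + 2) * poly A (1 / u) = (1 + u) ^ 2 * (u ^ j * poly P (1 / u))"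
        by (simp only:)
      also have "\<dots> = (-1) ^ j * poly A u"
        using reflect_poly_inverse[OF P(3), of u] P(2) that by (simp add: A_def mult_ac)
      finally have "u ^ (j + 2) * poly A (1 / u) = (-1) ^ j * poly A u" .
      moreover have "u ^ (j + 2) * poly R (1 / u) = (-1) ^ j * poly R u"
        using reflect_poly_inverse[OF R(3), of u] R(2) that by simp
      moreover have "u ^ (j + 2) * poly (A + smult \<delta> R) (1 / u) =
          u ^ (j + 2) * poly A (1 / u) + \<delta> * (u ^ (j + 2) * poly R (1 / u))"
        by (simp only: poly_add poly_smult algebra_simps)
      ultimately show ?thesis
        by (simp only: poly_add poly_smult algebra_simps)
    qed
  qed
qed

text \<open>The witness \<open>(n - j - 2) (n - j - 3) / n^2\<close> is
  \<open>eigenval n j / eigenval n (j + 2)\<close>; both factors of its numerator lie between 0 and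
  \<open>n\<close>.\<close>

lemma bernstein_val_ratio:
  assumes "j + 5 \<le> n"
  obtains \<rho> where "0 \<le> \<rho>" "\<rho> < 1" "bernstein_val n j = \<rho> * real n ^ 2 * bernstein_val n (j + 2)"
proof
  define p where "p = (real n - real (j + 2)) * (real n - real (j + 3))"
  have n: "0 < real n" "real (j + 2) < real n" "real (j + 3) < real n" using assms by linarith+
  show "0 \<le> p / real n ^ 2" using n by (simp add: p_def)
  have "p < real n * real n"
    unfolding p_def using n by (intro mult_strict_mono) auto
  then show "p / real n ^ 2 < 1" using n by (simp add: power2_eq_square)
  have "bernstein_val n j = p * bernstein_val n (j + 2)"
    using bernstein_val_Suc[of j n] bernstein_val_Suc[of "Suc j" n] assms by (simp add: p_def)
  then show "bernstein_val n j = p / real n ^ 2 * real n ^ 2 * bernstein_val n (j + 2)"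
    using n by simp
qed

lemma is_Q_root_inverse:
  assumes "reflect_poly Q = smult c Q" "t > 0" "poly Q t = 0"
  shows "poly Q (1 / t) = (0 :: real)"
  using reflect_poly_inverse[OF assms(1), of t] assms(2,3) by simp

text \<open>The \<open>j div 2 + 1\<close> roots of \<open>R\<close> below 1 bound
  \<open>j div 2\<close> gaps, each containing a root of \<open>P\<close> below 1. There are only
  \<open>j div 2\<close> such roots, and larger gaps get larger roots, so the assignment is the
  identity.\<close>

lemma roots_below_one_interlace:
  fixes P R :: "real poly"
  assumes x: "positive_roots_enum P j x" and z: "positive_roots_enum R (j + 2) z"
    and inv1: "\<And>t. t > 0 \<Longrightarrow> poly P t = 0 \<Longrightarrow> poly P (1 / t) = 0"
    and inv2: "\<And>t. t > 0 \<Longrightarrow> poly R t = 0 \<Longrightarrow> poly R (1 / t) = 0"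
    and wronskian: "\<And>t. 0 < t \<Longrightarrow> t < 1 \<Longrightarrow>
      poly ([:1, 1:] ^ 2 * P) t * poly (pderiv R) t - poly (pderiv ([:1, 1:] ^ 2 * P)) t * poly R t \<noteq> 0"
    and i: "1 \<le> i" "i \<le> j div 2"
  shows "z i < x i \<and> x i < z (i + 1)"
proof -
  define d where "d = j div 2"
  have "\<exists>k\<in>{1..d}. z i < x k \<and> x k < z (i + 1)" if i: "1 \<le> i" "i \<le> d" for i
  proof -
    have z1: "z (i + 1) < 1"
      using enum_less_one_iff[OF z inv2, of "i + 1"] i by (simp add: d_def)
    have z0: "0 < z i" using i by (intro enum_pos[OF z]) (auto simp: d_def)
    have "\<exists>t. z i < t \<and> t < z (i + 1) \<and> poly ([:1, 1:] ^ 2 * P) t = 0"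
    proof (rule root_between_roots)
      show "z i < z (i + 1)" using i by (intro enum_mono[OF z]) (auto simp: d_def)
      show "poly R (z i) = 0" "poly R (z (i + 1)) = 0"
        using i by (auto intro!: enum_root[OF z] simp: d_def)
    qed (use z0 z1 in \<open>intro wronskian; linarith\<close>)
    \<comment> \<open>The factor \<open>(1 + t)^2\<close> is nonzero for positive \<open>t\<close>,
      so the root belongs to \<open>P\<close>.\<close>
    then obtain t where t: "z i < t" "t < z (i + 1)" "poly P t = 0"
      using z0 by (auto simp: poly_mult)
    then obtain k where k: "k \<in> {1..j}" "t = x k"
      using enum_obtain[OF x] by blast
    have "k \<le> d"
      using enum_less_one_iff[OF x inv1, of k] k t z1 by (simp add: d_def)
    with k t show ?thesis by auto
  qed
  then obtain s where s: "\<And>i. 1 \<le> i \<Longrightarrow> i \<le> d \<Longrightarrow> s i \<in> {1..d}"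
    "\<And>i. 1 \<le> i \<Longrightarrow> i \<le> d \<Longrightarrow> z i < x (s i)" "\<And>i. 1 \<le> i \<Longrightarrow> i \<le> d \<Longrightarrow> x (s i) < z (i + 1)"
    by metis
  have s_id: "s i = i" if "1 \<le> i" "i \<le> d" for i
  proof (rule strict_mono_on_self_map[OF _ _ that])
    fix i k assume ik: "1 \<le> i" "i < k" "k \<le> d"
    have "k \<le> j + 2" using ik by (simp add: d_def)
    then have "z (i + 1) \<le> z k"
      using enum_mono[OF z, of "i + 1" k] ik by (cases "i + 1 = k") auto
    then have "x (s i) < x (s k)" using s(2)[of k] s(3)[of i] ik by simp
    moreover have "s i \<in> {1..j}" "s k \<in> {1..j}"
      using s(1)[of i] s(1)[of k] ik by (auto simp: d_def)
    ultimately show "s i < s k" using enum_mono_iff[OF x] by blast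
  qed (use s(1) in auto)
  show ?thesis
    using s(2,3)[of i] s_id[of i] i by (simp_all add: d_def)
qed

theorem theorem4:
  fixes n j :: nat
    and \<Phi> :: "complex poly \<Rightarrow> complex poly"
    and Qj Qj2 :: "real poly"
    and x z :: "nat \<Rightarrow> real"
  assumes "1 \<le> j" and "j + 5 \<le> n"
    and "is_Phi n \<Phi>"
    and "is_Q n \<Phi> j Qj"
    and "is_Q n \<Phi> (j + 2) Qj2"
    and "positive_roots_enum Qj j x"
    and "positive_roots_enum Qj2 (j + 2) z"
  shows "(\<forall>i\<in>{1..j div 2}. x i \<in> {z i<..<z (i + 1)} \<and>
            x (j + 1 - i) \<in> {z (j + 2 - i)<..<z (j + 3 - i)}) \<and>
         (odd j \<longrightarrow> x ((j + 1) div 2) = 1 \<and> z ((j + 3) div 2) = 1)"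
proof -
  note x = assms(6) and z = assms(7)
  have Q1: "degree Qj = j" "lead_coeff Qj = 1" and Q2: "degree Qj2 = j + 2" "lead_coeff Qj2 = 1"
    using assms(4,5) unfolding is_Q_def by blast+
  \<comment> \<open>All roots are positive, so -1 is not a root, as \<open>is_Q_imp\<close>
    requires.\<close>
  have ev1: "bernstein_eigen (n - 2) j (bernstein_val n j) Qj"
    and sym1: "reflect_poly Qj = smult ((-1) ^ j) Qj"
    using is_Q_imp[OF assms(3,4)] enum_nonzero_at_neg[OF x, of "-1"] assms(2) by simp_all
  \<comment> \<open>The sign \<open>(-1)^(j + 2)\<close> is written as \<open>(-1)^j\<close>, to
    agree with that of \<open>Qj\<close>.\<close>
  have ev2: "bernstein_eigen (n - 2) (j + 2) (bernstein_val n (j + 2)) Qj2"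
    and sym2: "reflect_poly Qj2 = smult ((-1) ^ j) Qj2"
    using is_Q_imp[OF assms(3,5)] enum_nonzero_at_neg[OF z, of "-1"] assms(2) by simp_all
  obtain \<rho> where \<rho>: "0 \<le> \<rho>" "\<rho> < 1" "bernstein_val n j = \<rho> * real n ^ 2 * bernstein_val n (j + 2)"
    using bernstein_val_ratio[OF assms(2)] .
  have "Qj2 \<noteq> 0" using Q2 by auto
  have wronskian: "poly ([:1, 1:] ^ 2 * Qj) t * poly (pderiv Qj2) t - poly (pderiv ([:1, 1:] ^ 2 * Qj)) t * poly Qj2 t \<noteq> 0"
    if "0 < t" "t < 1" for t
    using that assms(2) bernstein_val_pos[of j n] \<rho> enum_alternates[OF x Q1 assms(1)]
      enum_simple_root[OF z Q2(1) \<open>Qj2 \<noteq> 0\<close>]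
    by (intro bernstein_eigen_wronskian_nonzero[where \<rho> = \<rho>, OF ev1 Q1(1) sym1 ev2 Q2(1) sym2]) simp_all
  note inv1 = is_Q_root_inverse[OF sym1] and inv2 = is_Q_root_inverse[OF sym2]
  define d where "d = j div 2"
  have lower: "z i < x i \<and> x i < z (i + 1)" if "1 \<le> i" "i \<le> d" for i
    using that unfolding d_def by (intro roots_below_one_interlace[OF x z] inv1 inv2 wronskian)
  \<comment> \<open>Inversion reverses the inequalities below 1. It sends index \<open>i\<close> to
    \<open>j + 1 - i\<close> for \<open>x\<close> and to \<open>j + 3 - i\<close> for
    \<open>z\<close>, which has two more entries.\<close>
  have "z (j + 2 - i) < x (j + 1 - i)" "x (j + 1 - i) < z (j + 3 - i)" if i: "1 \<le> i" "i \<le> d" for i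
  proof -
    have pos: "0 < z i" "0 < x i" "0 < z (i + 1)"
      using i by (auto intro!: enum_pos[OF z] enum_pos[OF x] simp: d_def)
    have "x i * x (j + 1 - i) = 1"
      using enum_inverse[OF x inv1, of i] i by (simp add: d_def)
    moreover have "z i * z (j + 3 - i) = 1"
      using enum_inverse[OF z inv2, of i] i by (simp add: d_def numeral_3_eq_3)
    moreover have "z (i + 1) * z (j + 2 - i) = 1"
      using enum_inverse[OF z inv2, of "i + 1"] i by (simp add: d_def)
    ultimately have "x (j + 1 - i) = 1 / x i" "z (j + 3 - i) = 1 / z i" "z (j + 2 - i) = 1 / z (i + 1)"
      using pos by (simp_all add: eq_divide_eq mult.commute)
    then show "z (j + 2 - i) < x (j + 1 - i)" "x (j + 1 - i) < z (j + 3 - i)"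
      using lower[OF i] pos by (simp_all add: divide_strict_left_mono)
  qed
  moreover have "x ((j + 1) div 2) = 1 \<and> z ((j + 3) div 2) = 1" if "odd j"
    using enum_middle[OF x inv1] enum_middle[OF z inv2] that by (simp add: numeral_3_eq_3)
  ultimately show ?thesis
    using lower by (auto simp: d_def)
qed

end
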